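(* Let $\{\omega_n:n\in\mathbb Z\}$ be a nondecreasing sequence of real numbers that gives rise to a Fourier frame for $\mathcal H$ with frame bounds $A$ and $B$, let $N\in\mathbb N$, $\Omega=\{\omega_n:|n|\le N\}$, and let $\mathcal T$ be the reconstruction space of dimension $2^R$ consisting of either periodic, folded or boundary wavelets. Suppose $\phi$ satisfies $|\hat\phi(\omega)|\le c(1+|\omega|)^{-\alpha}$ for all $\omega\in\mathbb R$, for some constant $c$ and some $\alpha>\tfrac12$. Then given $0<\epsilon<A$ there exists $c_0=c_0(\epsilon)$ such that $$C(\Omega,\mathcal T)\le\sqrt{\frac{B}{A-\epsilon}}\qquad\text{whenever } N\ge c_0(\epsilon)2^R.$$
   Context: For $f\in L^2(\mathbb R)$, $\hat f(\omega)=\int_{\mathbb R}f(x)e^{-2\pi i\omega x}\,dx$; $\langle\cdot,\cdot\rangle$, $\|\cdot\|$ are the $L^2(\mathbb R)$ inner product and norm. $\mathcal H=\{f\in L^2(\mathbb R):\operatorname{supp}f\subseteq[0,1]\}$. Fourier frame: $\{\omega_n\}_{n\in\mathbb Z}$ gives rise to a Fourier frame for $\mathcal H$ with bounds $0<A\le B<\infty$ if $A\|f\|^2\le\sum_{n\in\mathbb Z}|\hat f(\omega_n)|^2\le B\|f\|^2$ for all $f\in\mathcal H$. Sampling operator (partial frame operator): $\mathcal S_Nf(x)=\sum_{n=-N}^N\hat f(\omega_n)e^{2\pi i\omega_nx}\mathbb 1_{[0,1]}(x)$. $C_1(\Omega,\mathcal T)=\inf_{0\ne f\in\mathcal T}\langle\mathcal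 S_Nf,f\rangle/\|f\|^2$, $C_2(\Omega)=\sup_{0\ne f\in\mathcal H}\langle\mathcal S_Nf,f\rangle/\|f\|^2$, $C(\Omega,\mathcal T)=\sqrt{C_2/C_1}$ ($+\infty$ if $C_1=0$). Wavelets: $\phi$ is the scaling function of a multiresolution analysis $(V_j)$ of $L^2(\mathbb R)$ (nested closed subspaces with dense union, trivial intersection, $f\in V_j\iff f(2\cdot)\in V_{j+1}$, $\{\phi(\cdot-k)\}_k$ a Riesz basis of $V_0$), compactly supported in $[-p+1,p]$, $p\in\mathbb N$; $\phi_{j,k}(x)=2^{j/2}\phi(2^jx-k)$. Periodic: $\mathcal T=\operatorname{span}\{\phi^{\mathrm{per}}_{R,k}\mathbb 1_{[0,1]}:k=0,\dots,2^R-1\}$ with $\phi^{\mathrm{per}}_{R,k}(x)=\sum_{l\in\mathbb Z}\phi_{R,k}(x+l)$. Folded: $\mathcal T=\operatorname{span}\{\phi^{\mathrm{fold}}_{R,k}\mathbb 1_{[0,1]}:k=0,\dots,2^R-\iota\}$ with $\phi^{\mathrm{fold}}_{R,k}(x)=\sum_{l}\phi_{R,k}(x-2l)+\sum_l\phi_{R,k}(2l-x)$ and $\iota\in\{0,1\}$ according as the wavelets are symmetric or antisymmetric. Boundary (Cohen–Daubechies–Vial): $\mathcal T=\operatorname{span}\{\phi^{\mathrm{int}}_{R,k}:k=0,\dots,2^R-1\}$, where $\phi^{\mathrm{int}}_{R,k}=\phi_{R,k}$ for $p\le k<2^R-p$, $\phi^{\mathrm{int}}_{R,k}(x)=2^{R/2}\phi^{\mathrm{left}}_k(2^Rx)$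 for $0\le k<p$, and $\phi^{\mathrm{int}}_{R,k}(x)=2^{R/2}\phi^{\mathrm{right}}_{2^R-k-1}(2^R(x-1))$ for $2^R-p\le k<2^R$, with $\phi^{\mathrm{left}}_k,\phi^{\mathrm{right}}_k$ the Cohen–Daubechies–Vial boundary scaling functions. *)

theory Defs
  imports "HOL-Analysis.Analysis"
begin

definition L2 :: "(real \<Rightarrow> complex) \<Rightarrow> bool" where
  "L2 f \<longleftrightarrow> f \<in> borel_measurable lborel \<and> integrable lborel (\<lambda>x. (cmod (f x))\<^sup>2)"

definition l2norm :: "(real \<Rightarrow> complex) \<Rightarrow> real" where
  "l2norm f = sqrt (LINT x|lborel. (cmod (f x))\<^sup>2)"

definition l2inner :: "(real \<Rightarrow> complex) \<Rightarrow> (real \<Rightarrow> complex) \<Rightarrow> complex" where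
  "l2inner f g = (LINT x|lborel. f x * cnj (g x))"

text \<open>Fourier transform with the convention hat f(w) = int f(x) e^{-2 pi i w x} dx.
  It is only ever applied to compactly supported L2 functions (hence L1 functions).\<close>
definition fourier :: "(real \<Rightarrow> complex) \<Rightarrow> real \<Rightarrow> complex" where
  "fourier f w = (LINT x|lborel. f x * cis (- 2 * pi * w * x))"

definition H_space :: "(real \<Rightarrow> complex) set" where
  "H_space = {f. L2 f \<and> (\<forall>x. x \<notin> {0..1} \<longrightarrow> f x = 0)}"

definition fourier_frame :: "(int \<Rightarrow> real) \<Rightarrow> real \<Rightarrow> real \<Rightarrow> bool" where
  "fourier_frame \<omega> A B \<longleftrightarrow> 0 < A \<and> A \<le> B \<and>
     (\<forall>f\<in>H_space. (\<lambda>n. (cmod (fourier f (\<omega> n)))\<^sup>2) summable_on UNIV \<and>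
        A * (l2norm f)\<^sup>2 \<le> (\<Sum>\<^sub>\<infinity>n. (cmod (fourier f (\<omega> n)))\<^sup>2) \<and>
        (\<Sum>\<^sub>\<infinity>n. (cmod (fourier f (\<omega> n)))\<^sup>2) \<le> B * (l2norm f)\<^sup>2)"

definition sampling_op :: "(int \<Rightarrow> real) \<Rightarrow> nat \<Rightarrow> (real \<Rightarrow> complex) \<Rightarrow> real \<Rightarrow> complex" where
  "sampling_op \<omega> N f x =
     (\<Sum>n\<in>{- int N..int N}. fourier f (\<omega> n) * cis (2 * pi * \<omega> n * x)) * indicator {0..1} x"

definition rayleigh :: "(int \<Rightarrow> real) \<Rightarrow> nat \<Rightarrow> (real \<Rightarrow> complex) \<Rightarrow> real" where
  "rayleigh \<omega> N f = Re (l2inner (sampling_op \<omega> N f) f) / (l2norm f)\<^sup>2"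

text \<open>Omega = {omega_n : |n| <= N} is encoded by the pair (omega, N).
  "f nonzero" means nonzero as an element of L2, i.e. nonzero norm.\<close>
definition C1 :: "(int \<Rightarrow> real) \<Rightarrow> nat \<Rightarrow> (real \<Rightarrow> complex) set \<Rightarrow> real" where
  "C1 \<omega> N T = Inf {rayleigh \<omega> N f | f. f \<in> T \<and> l2norm f \<noteq> 0}"

definition C2 :: "(int \<Rightarrow> real) \<Rightarrow> nat \<Rightarrow> real" where
  "C2 \<omega> N = Sup {rayleigh \<omega> N f | f. f \<in> H_space \<and> l2norm f \<noteq> 0}"

definition Cconst :: "(int \<Rightarrow> real) \<Rightarrow> nat \<Rightarrow> (real \<Rightarrow> complex) set \<Rightarrow> ereal" where
  "Cconst \<omega> N T = (if C1 \<omega> N T = 0 then \<infinity> else ereal (sqrt (C2 \<omega> N / C1 \<omega> N T)))"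

definition l2_subspace :: "(real \<Rightarrow> complex) set \<Rightarrow> bool" where
  "l2_subspace V \<longleftrightarrow> (\<forall>f\<in>V. L2 f) \<and> (\<lambda>x. 0) \<in> V \<and>
     (\<forall>f\<in>V. \<forall>g\<in>V. (\<lambda>x. f x + g x) \<in> V) \<and> (\<forall>c. \<forall>f\<in>V. (\<lambda>x. c * f x) \<in> V)"

definition l2_closed :: "(real \<Rightarrow> complex) set \<Rightarrow> bool" where
  "l2_closed V \<longleftrightarrow> (\<forall>f. L2 f \<and> (\<forall>e>0. \<exists>g\<in>V. l2norm (\<lambda>x. f x - g x) < e) \<longrightarrow> f \<in> V)"

definition riesz_basis_translates :: "(real \<Rightarrow> complex) \<Rightarrow> (real \<Rightarrow> complex) set \<Rightarrow> bool" where
  "riesz_basis_translates \<phi> V0 \<longleftrightarrow>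
     (\<forall>k::int. (\<lambda>x. \<phi> (x - of_int k)) \<in> V0) \<and>
     (\<exists>a b. 0 < a \<and> a \<le> b \<and> (\<forall>(c::int \<Rightarrow> complex) K. finite K \<longrightarrow>
        a * (\<Sum>k\<in>K. (cmod (c k))\<^sup>2) \<le> (l2norm (\<lambda>x. \<Sum>k\<in>K. c k * \<phi> (x - of_int k)))\<^sup>2 \<and>
        (l2norm (\<lambda>x. \<Sum>k\<in>K. c k * \<phi> (x - of_int k)))\<^sup>2 \<le> b * (\<Sum>k\<in>K. (cmod (c k))\<^sup>2))) \<and>
     (\<forall>f\<in>V0. \<forall>e>0. \<exists>K (c::int \<Rightarrow> complex). finite K \<and>
        l2norm (\<lambda>x. f x - (\<Sum>k\<in>K. c k * \<phi> (x - of_int k))) < e)"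

definition is_MRA :: "(int \<Rightarrow> (real \<Rightarrow> complex) set) \<Rightarrow> (real \<Rightarrow> complex) \<Rightarrow> bool" where
  "is_MRA V \<phi> \<longleftrightarrow>
     (\<forall>j. l2_subspace (V j) \<and> l2_closed (V j)) \<and>
     (\<forall>j. V j \<subseteq> V (j + 1)) \<and>
     (\<forall>f. L2 f \<longrightarrow> (\<forall>e>0. \<exists>j. \<exists>g\<in>V j. l2norm (\<lambda>x. f x - g x) < e)) \<and>
     (\<forall>f. (\<forall>j. f \<in> V j) \<longrightarrow> l2norm f = 0) \<and>
     (\<forall>j f. L2 f \<longrightarrow> (f \<in> V j \<longleftrightarrow> (\<lambda>x. f (2 * x)) \<in> V (j + 1))) \<and>
     riesz_basis_translates \<phi> (V 0)"

definition scaling_function :: "(real \<Rightarrow> complex) \<Rightarrow> bool" where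
  "scaling_function \<phi> \<longleftrightarrow> (\<exists>V. is_MRA V \<phi>)"

definition phiRk :: "(real \<Rightarrow> complex) \<Rightarrow> nat \<Rightarrow> int \<Rightarrow> real \<Rightarrow> complex" where
  "phiRk \<phi> R k x = complex_of_real (2 powr (real R / 2)) * \<phi> (2 ^ R * x - of_int k)"

definition phi_per :: "(real \<Rightarrow> complex) \<Rightarrow> nat \<Rightarrow> int \<Rightarrow> real \<Rightarrow> complex" where
  "phi_per \<phi> R k x = (\<Sum>\<^sub>\<infinity>l::int. phiRk \<phi> R k (x + of_int l))"

definition phi_fold :: "(real \<Rightarrow> complex) \<Rightarrow> nat \<Rightarrow> int \<Rightarrow> real \<Rightarrow> complex" where
  "phi_fold \<phi> R k x = (\<Sum>\<^sub>\<infinity>l::int. phiRk \<phi> R k (x - 2 * of_int l))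
                       + (\<Sum>\<^sub>\<infinity>l::int. phiRk \<phi> R k (2 * of_int l - x))"

definition T_per :: "(real \<Rightarrow> complex) \<Rightarrow> nat \<Rightarrow> (real \<Rightarrow> complex) set" where
  "T_per \<phi> R = {(\<lambda>x. (\<Sum>k<2 ^ R. c k * phi_per \<phi> R (int k) x) * indicator {0..1} x)
                 | c :: nat \<Rightarrow> complex. True}"

definition T_fold :: "(real \<Rightarrow> complex) \<Rightarrow> nat \<Rightarrow> nat \<Rightarrow> (real \<Rightarrow> complex) set" where
  "T_fold \<phi> \<iota> R = {(\<lambda>x. (\<Sum>k\<in>{0..2 ^ R - \<iota>}. c k * phi_fold \<phi> R (int k) x) * indicator {0..1} x)
                 | c :: nat \<Rightarrow> complex. True}"

text \<open>iota = 0 for symmetric wavelets (scaling function symmetric about 0),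
  iota = 1 for antisymmetric wavelets (scaling function symmetric about 1/2).\<close>
definition fold_iota :: "(real \<Rightarrow> complex) \<Rightarrow> nat \<Rightarrow> bool" where
  "fold_iota \<phi> \<iota> \<longleftrightarrow> (\<iota> = 0 \<and> (\<forall>x. \<phi> (- x) = \<phi> x)) \<or> (\<iota> = 1 \<and> (\<forall>x. \<phi> (1 - x) = \<phi> x))"

text \<open>Cohen--Daubechies--Vial boundary functions, up to the (span preserving)
  Gram--Schmidt orthonormalisation: the left edge functions are the half-line restrictions
  of sum_{n=-p+1}^{p-1} n^m phi(y - n), the right edge functions those of
  sum_{n=-p}^{p-1} n^m phi(y - n) to y <= 0, for m = 0..p-1.\<close>
definition L_edge :: "(real \<Rightarrow> complex) \<Rightarrow> nat \<Rightarrow> nat \<Rightarrow> real \<Rightarrow> complex" where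
  "L_edge \<phi> p m y = (\<Sum>n\<in>{- int p + 1..int p - 1}. (of_int n) ^ m * \<phi> (y - of_int n)) * indicator {0..} y"

definition R_edge :: "(real \<Rightarrow> complex) \<Rightarrow> nat \<Rightarrow> nat \<Rightarrow> real \<Rightarrow> complex" where
  "R_edge \<phi> p m y = (\<Sum>n\<in>{- int p..int p - 1}. (of_int n) ^ m * \<phi> (y - of_int n)) * indicator {..0} y"

definition T_bdry :: "(real \<Rightarrow> complex) \<Rightarrow> nat \<Rightarrow> nat \<Rightarrow> (real \<Rightarrow> complex) set" where
  "T_bdry \<phi> p R = {(\<lambda>x. (\<Sum>m<p. a m * complex_of_real (2 powr (real R / 2)) * L_edge \<phi> p m (2 ^ R * x)
                        + b m * complex_of_real (2 powr (real R / 2)) * R_edge \<phi> p m (2 ^ R * (x - 1)))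
                   + (\<Sum>k\<in>{p..<2 ^ R - p}. c k * phiRk \<phi> R (int k) x))
                 | a b c :: nat \<Rightarrow> complex. True}"

datatype wavelet_kind = Periodic | Folded nat | Boundary

fun recon_space :: "wavelet_kind \<Rightarrow> (real \<Rightarrow> complex) \<Rightarrow> nat \<Rightarrow> nat \<Rightarrow> (real \<Rightarrow> complex) set" where
  "recon_space Periodic \<phi> p R = T_per \<phi> R"
| "recon_space (Folded \<iota>) \<phi> p R = T_fold \<phi> \<iota> R"
| "recon_space Boundary \<phi> p R = T_bdry \<phi> p R"

end

theory Submission
  imports Defs
begin

text \<open>Rescaled by \<open>2\<^sup>R\<close> and cut at the integers, every function of the reconstruction space has pieces
  in one fixed finite-dimensional subspace \<open>W\<close> of \<open>L\<^sup>2[0,1)\<close>, spanned by the translates of \<open>\<phi>\<close>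
  restricted to the unit interval; this holds at the boundary as well. By density and finite
  dimension, some \<open>q\<close> works for all of \<open>W\<close>: every \<open>w \<in> W\<close> is close, relative to its norm, to a step
  function on the grid \<open>2\<^sup>-\<^sup>q\<close>. Hence every \<open>f\<close> in the reconstruction space is relatively close to a
  step function \<open>s\<close> on the grid of mesh \<open>1 / M\<close> with \<open>M = 2\<^sup>R\<^sup>+\<^sup>q\<close>. The samples of \<open>f - s\<close> are controlled by
  the upper frame bound. For \<open>s\<close> the product of \<open>w\<close> and the transform at \<open>w\<close> is \<open>M\<close>-periodic, so the upper
  frame bound applied to modulations of \<open>s\<close> shows that the samples with \<open>\<bar>\<omega>\<^sub>n\<bar> \<ge> K M\<close> carry energy
  \<open>O(\<parallel>s\<parallel>\<^sup>2 / K)\<close>. Finally \<open>O(L)\<close> of the \<open>\<omega>\<^sub>n\<close> lie in \<open>[-L, L]\<close>, so \<open>\<bar>\<omega>\<^sub>n\<bar> \<ge> K M\<close> whenever \<open>\<bar>n\<bar> > N\<close> and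
  \<open>N\<close> is at least a constant times \<open>M\<close>.\<close>

section \<open>Square-integrable functions and the Fourier transform\<close>

text \<open>Two requirements shape the proof. First, one choice of \<open>q\<close> and of the
  cut-off \<open>K\<close> must serve every R and every f, with an error proportional to the square
  norm of f. Working cell by cell achieves this: rescaling a cell multiplies its error and its
  square norm by the same factor, and the contributions of disjoint cells simply add. Second,
  \<open>C1\<close> is an infimum over the reals, which carries no information for an empty set, so
  each reconstruction space must be shown to contain a function of nonzero norm. In all three cases
  there is one that equals, on the first cell, a nonzero multiple of the sum of all integer
  translates of \<phi>, and the lower Riesz bound prevents this sum from vanishing almost
  everywhere. Estimates are kept in terms of the square norm \<open>sqn\<close>, so each triangle
  inequality costs a factor 2; the numerical constants 4, 10 and 64 below are products and sums of
  such factors.\<close>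

definition sqn :: "(real \<Rightarrow> complex) \<Rightarrow> real" where
  "sqn f = (LINT x|lborel. (cmod (f x))\<^sup>2)"

lemma sqn_nonneg [simp]: "0 \<le> sqn f"
  by (simp add: sqn_def)

lemma sqn_zero [simp]: "sqn (\<lambda>x. 0) = 0"
  by (simp add: sqn_def)

lemma l2norm_power2: "(l2norm f)\<^sup>2 = sqn f"
  by (simp add: l2norm_def sqn_def)

lemma l2norm_eq_0_iff: "l2norm f = 0 \<longleftrightarrow> sqn f = 0"
  by (simp add: l2norm_def sqn_def)

lemma cmod_add_sq_le: "(cmod (a + b))\<^sup>2 \<le> 2 * (cmod a)\<^sup>2 + 2 * (cmod b)\<^sup>2"
proof -
  have "(cmod (a + b))\<^sup>2 \<le> (cmod a + cmod b)\<^sup>2"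
    by (intro power_mono norm_triangle_ineq) auto
  also have "\<dots> \<le> 2 * (cmod a)\<^sup>2 + 2 * (cmod b)\<^sup>2"
    using zero_le_power2[of "cmod a - cmod b"] by (simp add: power2_eq_square algebra_simps)
  finally show ?thesis .
qed

lemma L2_borel_measurable: "L2 f \<Longrightarrow> f \<in> borel_measurable borel"
  by (simp add: L2_def)

lemma L2_integrable: "L2 f \<Longrightarrow> integrable lborel (\<lambda>x. (cmod (f x))\<^sup>2)"
  by (simp add: L2_def)

lemma L2_dominated:
  assumes [measurable]: "f \<in> borel_measurable borel"
    and "integrable lborel g" "\<And>x. (cmod (f x))\<^sup>2 \<le> g x"
  shows "L2 f"
  unfolding L2_def
proof
  show "integrable lborel (\<lambda>x. (cmod (f x))\<^sup>2)"
    by (rule Bochner_Integration.integrable_bound[OF assms(2)])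
       (use assms(3) in \<open>auto intro!: AE_I2 intro: order_trans abs_ge_self\<close>)
qed simp

lemma L2_zero [simp]: "L2 (\<lambda>x. 0)"
  by (simp add: L2_def)

lemma L2_cmult: "L2 f \<Longrightarrow> L2 (\<lambda>x. c * f x)"
  by (auto simp: L2_def norm_mult power_mult_distrib)

lemma L2_add:
  assumes "L2 f" "L2 g"
  shows "L2 (\<lambda>x. f x + g x)"
proof (rule L2_dominated)
  show "(\<lambda>x. f x + g x) \<in> borel_measurable borel"
    using assms[THEN L2_borel_measurable] by simp
  show "integrable lborel (\<lambda>x. 2 * (cmod (f x))\<^sup>2 + 2 * (cmod (g x))\<^sup>2)"
    using assms[THEN L2_integrable] by simp
qed (rule cmod_add_sq_le)

lemma L2_uminus: "L2 f \<Longrightarrow> L2 (\<lambda>x. - f x)"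
  using L2_cmult[of f "-1"] by simp

lemma L2_diff: "L2 f \<Longrightarrow> L2 g \<Longrightarrow> L2 (\<lambda>x. f x - g x)"
  using L2_add[OF _ L2_uminus, of f g] by simp

lemma L2_sum: "(\<And>i. i \<in> I \<Longrightarrow> L2 (f i)) \<Longrightarrow> L2 (\<lambda>x. \<Sum>i\<in>I. f i x)"
  by (induction I rule: infinite_finite_induct) (auto intro: L2_add)

lemma sqn_cmult: "sqn (\<lambda>x. c * f x) = (cmod c)\<^sup>2 * sqn f"
  by (simp add: sqn_def norm_mult power_mult_distrib)

lemma sqn_add_le:
  assumes "L2 f" "L2 g"
  shows "sqn (\<lambda>x. f x + g x) \<le> 2 * sqn f + 2 * sqn g"
proof -
  note I = assms[THEN L2_integrable] L2_add[OF assms, THEN L2_integrable]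
  have "sqn (\<lambda>x. f x + g x) \<le> (LINT x|lborel. 2 * (cmod (f x))\<^sup>2 + 2 * (cmod (g x))\<^sup>2)"
    unfolding sqn_def using I by (intro integral_mono cmod_add_sq_le) auto
  also have "\<dots> = 2 * sqn f + 2 * sqn g"
    unfolding sqn_def using I by (subst Bochner_Integration.integral_add) auto
  finally show ?thesis .
qed

lemma sqn_minus_commute: "sqn (\<lambda>x. f x - g x) = sqn (\<lambda>x. g x - f x)"
  by (simp add: sqn_def norm_minus_commute)

lemma sqn_diff_le:
  assumes "L2 f" "L2 g"
  shows "sqn (\<lambda>x. f x - g x) \<le> 2 * sqn f + 2 * sqn g"
  using sqn_add_le[OF assms(1) L2_uminus[OF assms(2)]] by (simp add: sqn_def)

lemma sqn_triangle:
  assumes "L2 f" "L2 g" "L2 h"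
  shows "sqn (\<lambda>x. f x - h x) \<le> 2 * sqn (\<lambda>x. f x - g x) + 2 * sqn (\<lambda>x. g x - h x)"
  using sqn_add_le[OF L2_diff[OF assms(1,2)] L2_diff[OF assms(2,3)]] by simp

lemma sqn_eq_0_iff:
  assumes "L2 f"
  shows "sqn f = 0 \<longleftrightarrow> (AE x in lborel. f x = 0)"
  unfolding sqn_def using L2_integrable[OF assms]
  by (subst integral_nonneg_eq_0_iff_AE) auto

lemma sqn_cong_AE:
  assumes "L2 f" "L2 g" "AE x in lborel. f x = g x"
  shows "sqn f = sqn g"
  unfolding sqn_def using assms by (intro integral_cong_AE) (auto simp: L2_def)

lemma sqn_affine:
  assumes "c \<noteq> 0"
  shows "sqn (\<lambda>x. f (t + c * x)) = sqn f / \<bar>c\<bar>"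
  unfolding sqn_def using lborel_integral_real_affine[OF assms, of "\<lambda>x. (cmod (f x))\<^sup>2" t] assms
  by simp

lemma L2_affine:
  assumes "L2 f" "c \<noteq> 0"
  shows "L2 (\<lambda>x. f (t + c * x))"
  unfolding L2_def
proof
  show "(\<lambda>x. f (t + c * x)) \<in> borel_measurable lborel"
    using L2_borel_measurable[OF assms(1)] by simp
  show "integrable lborel (\<lambda>x. (cmod (f (t + c * x)))\<^sup>2)"
    using lborel_integrable_real_affine[OF L2_integrable[OF assms(1)] assms(2), of t] by simp
qed

lemma L2_shift: "L2 f \<Longrightarrow> L2 (\<lambda>x. f (x - t))"
  using L2_affine[of f 1 "-t"] by simp

lemma L2_scale_shift: "L2 f \<Longrightarrow> c \<noteq> 0 \<Longrightarrow> L2 (\<lambda>x. f (c * x - t))"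
  using L2_affine[of f c "-t"] by simp

lemma sqn_shift: "sqn (\<lambda>x. f (x - t)) = sqn f"
  using sqn_affine[of 1 f "-t"] by simp

lemma sqn_scale_shift: "c > 0 \<Longrightarrow> sqn (\<lambda>x. f (c * x - t)) = sqn f / c"
  using sqn_affine[of c f "-t"] by simp

lemma L2_indicator_mult:
  assumes "L2 f" "A \<in> sets borel"
  shows "L2 (\<lambda>x. f x * indicator A x)"
proof (rule L2_dominated[OF _ L2_integrable[OF assms(1)]])
  show "(\<lambda>x. f x * indicator A x) \<in> borel_measurable borel"
    using L2_borel_measurable[OF assms(1)] assms(2) by simp
qed (auto simp: indicator_def)

lemma L2_indicator:
  assumes "A \<in> sets borel" "A \<subseteq> {a..b}"
  shows "L2 (indicator A)"
proof (rule L2_dominated[where g = "indicator {a..b}"])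
  show "integrable lborel (indicator {a..b} :: real \<Rightarrow> real)"
    by (rule integrable_real_indicator) (auto simp: emeasure_lborel_Icc_eq)
qed (use assms in \<open>auto simp: indicator_def\<close>)

text \<open>The pointwise limit inherits the bound by g, so 4|g|^2 is an integrable majorant of |f -
  s i|^2.\<close>

lemma sqn_tendsto_dominated:
  assumes "\<And>i. L2 (s i)" "L2 f" "L2 g"
    and "\<And>x. (\<lambda>i. s i x) \<longlonglongrightarrow> f x" "\<And>i x. cmod (s i x) \<le> cmod (g x)"
  shows "(\<lambda>i. sqn (\<lambda>x. f x - s i x)) \<longlonglongrightarrow> 0"
proof -
  have [measurable]: "s i \<in> borel_measurable borel" "f \<in> borel_measurable borel" for i
    using assms(1,2) by (auto simp: L2_def)
  have "(\<lambda>i. LINT x|lborel. (cmod (f x - s i x))\<^sup>2) \<longlonglongrightarrow> (LINT x::real|lborel. (0::real))"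
  proof (rule integral_dominated_convergence[where w = "\<lambda>x. 4 * (cmod (g x))\<^sup>2"])
    show "AE x in lborel. (\<lambda>i. (cmod (f x - s i x))\<^sup>2) \<longlonglongrightarrow> 0"
    proof (rule AE_I2)
      fix x
      have "(\<lambda>i. (cmod (f x - s i x))\<^sup>2) \<longlonglongrightarrow> (cmod (f x - f x))\<^sup>2"
        by (intro tendsto_intros assms)
      then show "(\<lambda>i. (cmod (f x - s i x))\<^sup>2) \<longlonglongrightarrow> 0" by simp
    qed
    show "AE x in lborel. norm ((cmod (f x - s i x))\<^sup>2) \<le> 4 * (cmod (g x))\<^sup>2" for i
    proof (rule AE_I2)
      fix x
      have "cmod (f x) \<le> cmod (g x)"
        by (rule LIMSEQ_le_const2[OF tendsto_norm[OF assms(4)]]) (use assms(5) in auto)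
      then have "(cmod (f x))\<^sup>2 \<le> (cmod (g x))\<^sup>2" "(cmod (s i x))\<^sup>2 \<le> (cmod (g x))\<^sup>2"
        using assms(5) by (auto intro!: power_mono)
      then show "norm ((cmod (f x - s i x))\<^sup>2) \<le> 4 * (cmod (g x))\<^sup>2"
        using cmod_add_sq_le[of "f x" "- s i x"] unfolding norm_minus_cancel real_norm_def by (simp del: power_mono_iff)
    qed
  qed (use assms(3) in \<open>auto simp: L2_def\<close>)
  then show ?thesis by (simp add: sqn_def)
qed

text \<open>In place of Cauchy-Schwarz: t \<le> t^2 + 1 on [0,1], and f vanishes elsewhere.\<close>

lemma H_space_integrable:
  assumes "f \<in> H_space"
  shows "integrable lborel f"
proof (rule Bochner_Integration.integrable_bound)
  show "integrable lborel (\<lambda>x. (cmod (f x))\<^sup>2 + indicator {0..1} x)"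
    using assms by (intro Bochner_Integration.integrable_add integrable_real_indicator)
      (auto simp: H_space_def L2_def emeasure_lborel_Icc_eq)
  show "f \<in> borel_measurable lborel"
    using assms by (auto simp: H_space_def L2_def)
  have "cmod (f x) \<le> (cmod (f x))\<^sup>2 + indicator {0..1} x" for x
  proof (cases "x \<in> {0..1}")
    case True
    have "cmod (f x) \<le> (cmod (f x))\<^sup>2 + 1"
      using zero_le_power2[of "cmod (f x) - 1/2"] by (simp add: power2_eq_square algebra_simps)
    with True show ?thesis by simp
  next
    case False
    then show ?thesis using assms by (simp add: H_space_def)
  qed
  then show "AE x in lborel. cmod (f x) \<le> norm ((cmod (f x))\<^sup>2 + indicator {0..1} x :: real)"
    by (intro AE_I2) (auto intro: order_trans abs_ge_self)
qed

lemma integrable_mult_cis: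
  assumes "integrable lborel f"
  shows "integrable lborel (\<lambda>x. f x * cis (c * x))"
proof (rule Bochner_Integration.integrable_bound[OF assms])
  have "(\<lambda>x. cis (c * x)) \<in> borel_measurable borel"
    by (intro borel_measurable_continuous_onI continuous_intros)
  then show "(\<lambda>x. f x * cis (c * x)) \<in> borel_measurable lborel"
    using assms by auto
qed (auto simp: norm_mult)

lemma fourier_integrable: "f \<in> H_space \<Longrightarrow> integrable lborel (\<lambda>x. f x * cis (- 2 * pi * w * x))"
  using integrable_mult_cis[OF H_space_integrable, of f "- 2 * pi * w"] by simp

lemma H_space_diff: "f \<in> H_space \<Longrightarrow> g \<in> H_space \<Longrightarrow> (\<lambda>x. f x - g x) \<in> H_space"
  by (auto simp: H_space_def L2_diff)

lemma H_space_mult_cis: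
  assumes "f \<in> H_space"
  shows "(\<lambda>x. f x * cis (c * x)) \<in> H_space"
proof -
  have "(\<lambda>x. cis (c * x)) \<in> borel_measurable borel"
    by (intro borel_measurable_continuous_onI continuous_intros)
  then show ?thesis using assms by (auto simp: H_space_def L2_def norm_mult)
qed

lemma sqn_mult_cis: "sqn (\<lambda>x. f x * cis (c * x)) = sqn f"
  by (simp add: sqn_def norm_mult)

lemma fourier_add:
  "f \<in> H_space \<Longrightarrow> g \<in> H_space \<Longrightarrow> fourier (\<lambda>x. f x + g x) w = fourier f w + fourier g w"
  unfolding fourier_def using fourier_integrable[of f w] fourier_integrable[of g w]
  by (simp add: distrib_right)

lemma fourier_mult_cis: "fourier (\<lambda>x. f x * cis (2 * pi * v * x)) w = fourier f (w - v)"
  unfolding fourier_def by (intro Bochner_Integration.integral_cong)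
    (auto simp: cis_mult algebra_simps)

text \<open>Expanding the sampling operator inside the inner product pairs each sample with its own
  conjugate; the cut-off to [0,1] disappears because f is zero outside. From here on
  \<open>C1\<close> and \<open>C2\<close> are statements about finite sums of squared
  samples.\<close>

lemma rayleigh_eq:
  assumes "f \<in> H_space"
  shows "rayleigh \<omega> N f = (\<Sum>n\<in>{- int N..int N}. (cmod (fourier f (\<omega> n)))\<^sup>2) / sqn f"
proof -
  have cnj_hat: "(LINT x|lborel. cis (2 * pi * w * x) * cnj (f x)) = cnj (fourier f w)"
    and int_hat: "integrable lborel (\<lambda>x. cis (2 * pi * w * x) * cnj (f x))" for w
  proof -
    have eq: "(\<lambda>x. cis (2 * pi * w * x) * cnj (f x)) = (\<lambda>x. cnj (f x * cis (- 2 * pi * w * x)))"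
      by (auto simp: cis_cnj mult.commute)
    show "(LINT x|lborel. cis (2 * pi * w * x) * cnj (f x)) = cnj (fourier f w)"
      unfolding eq fourier_def by (rule Bochner_Integration.integral_cnj)
    show "integrable lborel (\<lambda>x. cis (2 * pi * w * x) * cnj (f x))"
      unfolding eq using fourier_integrable[OF assms, of w] by (subst complex_integrable_cnj)
  qed
  have "sampling_op \<omega> N f x * cnj (f x) =
      (\<Sum>n\<in>{- int N..int N}. fourier f (\<omega> n) * (cis (2 * pi * \<omega> n * x) * cnj (f x)))" for x
    using assms by (auto simp: sampling_op_def H_space_def indicator_def sum_distrib_right mult.assoc)
  then have "l2inner (sampling_op \<omega> N f) f =
      (\<Sum>n\<in>{- int N..int N}. fourier f (\<omega> n) * cnj (fourier f (\<omega> n)))"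
    unfolding l2inner_def using int_hat by (simp add: cnj_hat)
  also have "\<dots> = (\<Sum>n\<in>{- int N..int N}. complex_of_real ((cmod (fourier f (\<omega> n)))\<^sup>2))"
    by (simp only: complex_norm_square)
  finally show ?thesis by (simp add: rayleigh_def l2norm_power2)
qed

section \<open>Dyadic step functions\<close>

text \<open>Half-open cells make the value at any point of [0,1) a single coefficient, selected by a
  floor; at the point 1 the function is 0.\<close>

definition dyadic :: "nat \<Rightarrow> (nat \<Rightarrow> complex) \<Rightarrow> real \<Rightarrow> complex" where
  "dyadic q b x = (\<Sum>i<2 ^ q. b i * indicator {real i / 2 ^ q..<(real i + 1) / 2 ^ q} x)"

lemma dyadic_L2: "L2 (dyadic q b)"
  unfolding dyadic_def
proof (intro L2_sum L2_cmult)
  fix i show "L2 (indicator {real i / 2 ^ q..<(real i + 1) / 2 ^ q})"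
    by (rule L2_indicator[of _ "real i / 2 ^ q" "(real i + 1) / 2 ^ q"]) auto
qed

lemma mem_dyadic_interval_iff:
  assumes "0 \<le> x"
  shows "x \<in> {real i / 2 ^ q..<(real i + 1) / 2 ^ q} \<longleftrightarrow> i = nat \<lfloor>2 ^ q * x\<rfloor>"
proof -
  have "x \<in> {real i / 2 ^ q..<(real i + 1) / 2 ^ q} \<longleftrightarrow> \<lfloor>2 ^ q * x\<rfloor> = int i"
    by (simp add: floor_eq_iff divide_le_eq less_divide_eq mult.commute)
  also have "\<dots> \<longleftrightarrow> i = nat \<lfloor>2 ^ q * x\<rfloor>"
    using assms by auto
  finally show ?thesis .
qed

lemma dyadic_floor_less:
  assumes "x \<in> {0..<1}"
  shows "nat \<lfloor>2 ^ q * x\<rfloor> < 2 ^ q"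
proof -
  have "\<lfloor>2 ^ q * x\<rfloor> < 2 ^ q"
    using assms by (simp add: floor_less_iff)
  then show ?thesis
    by (simp only: nat_less_numeral_power_cancel_iff)
qed

lemma dyadic_eq:
  assumes "x \<in> {0..<1}"
  shows "dyadic q b x = b (nat \<lfloor>2 ^ q * x\<rfloor>)"
proof -
  have "dyadic q b x = (\<Sum>i<2 ^ q. if i = nat \<lfloor>2 ^ q * x\<rfloor> then b i else 0)"
    unfolding dyadic_def using assms mem_dyadic_interval_iff[of x _ q]
    by (intro sum.cong) (auto simp: indicator_def)
  also have "\<dots> = b (nat \<lfloor>2 ^ q * x\<rfloor>)"
    using dyadic_floor_less[OF assms, of q] by simp
  finally show ?thesis .
qed

lemma dyadic_outside:
  assumes "x \<notin> {0..<1}"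
  shows "dyadic q b x = 0"
  unfolding dyadic_def
proof (intro sum.neutral ballI)
  fix i :: nat assume "i \<in> {..<2 ^ q}"
  then have "real i + 1 \<le> 2 ^ q"
    using Suc_leI[of i "2 ^ q"] of_nat_mono[of "Suc i" "2 ^ q", where 'a = real] by simp
  then have "(real i + 1) / 2 ^ q \<le> 1"
    by simp
  moreover have "0 \<le> real i / 2 ^ q"
    by simp
  ultimately have "x \<notin> {real i / 2 ^ q..<(real i + 1) / 2 ^ q}"
    using assms order_trans[of 0 "real i / 2 ^ q" x] by (auto simp del: divide_le_eq_1_pos)
  then show "b i * indicator {real i / 2 ^ q..<(real i + 1) / 2 ^ q} x = 0"
    by simp
qed

lemma dyadic_cong:
  assumes "\<And>x. x \<in> {0..<1} \<Longrightarrow> f x = b (nat \<lfloor>2 ^ q * x\<rfloor>)" "\<And>x. x \<notin> {0..<1} \<Longrightarrow> f x = 0"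
  shows "f = dyadic q b"
proof
  fix x show "f x = dyadic q b x"
    using assms[of x] by (cases "x \<in> {0..<1}") (simp_all add: dyadic_eq dyadic_outside)
qed

lemma dyadic_add: "dyadic q b x + dyadic q b' x = dyadic q (\<lambda>i. b i + b' i) x"
  by (simp add: dyadic_def distrib_right sum.distrib)

lemma dyadic_cmult: "c * dyadic q b x = dyadic q (\<lambda>i. c * b i) x"
  unfolding dyadic_def sum_distrib_left by (intro sum.cong) (auto simp: mult.assoc)

lemma floor_dyadic_div: "\<lfloor>2 ^ (q + d) * x\<rfloor> div 2 ^ d = \<lfloor>2 ^ q * (x::real)\<rfloor>"
  using floor_divide_real_eq_div[of "2 ^ d" "2 ^ (q + d) * x"] by (simp add: power_add)

text \<open>The cell i of the fine grid lies in the cell i div 2^d of the coarse one. This brings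
  two approximations onto a common grid.\<close>

lemma dyadic_refine:
  assumes "q \<le> q'"
  obtains b' where "dyadic q b = dyadic q' b'"
proof -
  obtain d where q': "q' = q + d"
    using assms le_Suc_ex by blast
  have "dyadic q b = dyadic q' (\<lambda>i. b (i div 2 ^ d))"
  proof (rule dyadic_cong)
    fix x :: real assume x: "x \<in> {0..<1}"
    have "nat \<lfloor>2 ^ q' * x\<rfloor> div 2 ^ d = nat \<lfloor>2 ^ q * x\<rfloor>"
      using x floor_dyadic_div[of q d x] unfolding q'
      by (metis nat_div_distrib' nat_numeral nat_power_eq zero_le_numeral zero_le_power)
    then show "dyadic q b x = b (nat \<lfloor>2 ^ q' * x\<rfloor> div 2 ^ d)"
      by (simp add: dyadic_eq[OF x])
  qed (rule dyadic_outside)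
  then show ?thesis by (rule that)
qed

section \<open>Density of the dyadic step functions\<close>

definition dyadic_approx :: "(real \<Rightarrow> complex) \<Rightarrow> bool" where
  "dyadic_approx f \<longleftrightarrow> L2 f \<and> (\<forall>\<delta>>0. \<exists>q b. sqn (\<lambda>x. f x - dyadic q b x) \<le> \<delta>)"

lemma dyadic_approxE:
  assumes "dyadic_approx f" "\<delta> > 0"
  obtains q b where "sqn (\<lambda>x. f x - dyadic q b x) \<le> \<delta>"
  using assms unfolding dyadic_approx_def by blast

lemma dyadic_approx_limit:
  assumes "L2 f" "\<And>\<delta>. \<delta> > 0 \<Longrightarrow> \<exists>g. dyadic_approx g \<and> sqn (\<lambda>x. f x - g x) \<le> \<delta>"
  shows "dyadic_approx f"
  unfolding dyadic_approx_def
proof (intro conjI allI impI)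
  fix \<delta> :: real assume "\<delta> > 0"
  then obtain g where g: "dyadic_approx g" "sqn (\<lambda>x. f x - g x) \<le> \<delta> / 4"
    using assms(2)[of "\<delta> / 4"] by auto
  have "\<delta> / 4 > 0"
    using \<open>\<delta> > 0\<close> by simp
  with g(1) obtain q b where qb: "sqn (\<lambda>x. g x - dyadic q b x) \<le> \<delta> / 4"
    by (rule dyadic_approxE)
  have "sqn (\<lambda>x. f x - dyadic q b x) \<le> \<delta>"
    using sqn_triangle[OF assms(1) _ dyadic_L2, of g q b] g qb by (auto simp: dyadic_approx_def)
  then show "\<exists>q b. sqn (\<lambda>x. f x - dyadic q b x) \<le> \<delta>" by blast
qed fact

lemma dyadic_approx_dominated_limit:
  assumes "\<And>i. dyadic_approx (s i)" "L2 f" "L2 g"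
    and "\<And>x. (\<lambda>i. s i x) \<longlonglongrightarrow> f x" "\<And>i x. cmod (s i x) \<le> cmod (g x)"
  shows "dyadic_approx f"
proof (rule dyadic_approx_limit[OF assms(2)])
  fix \<delta> :: real assume "\<delta> > 0"
  have "(\<lambda>i. sqn (\<lambda>x. f x - s i x)) \<longlonglongrightarrow> 0"
    by (rule sqn_tendsto_dominated[where g = g])
      (use assms in \<open>auto simp: dyadic_approx_def\<close>)
  then have "\<forall>\<^sub>F i in sequentially. sqn (\<lambda>x. f x - s i x) < \<delta>"
    using \<open>\<delta> > 0\<close> by (rule order_tendstoD)
  then obtain i where "sqn (\<lambda>x. f x - s i x) < \<delta>"
    using eventually_sequentially by auto
  then show "\<exists>g. dyadic_approx g \<and> sqn (\<lambda>x. f x - g x) \<le> \<delta>"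
    using assms(1) less_imp_le by blast
qed

lemma dyadic_approx_dyadic: "dyadic_approx (dyadic q b)"
  unfolding dyadic_approx_def
proof (intro conjI allI impI)
  show "\<exists>q' b'. sqn (\<lambda>x. dyadic q b x - dyadic q' b' x) \<le> \<delta>" if "\<delta> > 0" for \<delta>
    using that by (intro exI[of _ q] exI[of _ b]) simp
qed (rule dyadic_L2)

lemma dyadic_approx_add:
  assumes "dyadic_approx f" "dyadic_approx g"
  shows "dyadic_approx (\<lambda>x. f x + g x)"
  unfolding dyadic_approx_def
proof (intro conjI allI impI)
  have L2: "L2 f" "L2 g"
    using assms by (auto simp: dyadic_approx_def)
  show "L2 (\<lambda>x. f x + g x)"
    by (rule L2_add[OF L2])
  fix \<delta> :: real assume "\<delta> > 0"
  then have \<delta>4: "\<delta> / 4 > 0" by simp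
  obtain q b where b: "sqn (\<lambda>x. f x - dyadic q b x) \<le> \<delta> / 4"
    using assms(1) \<delta>4 by (rule dyadic_approxE)
  obtain q' b' where b': "sqn (\<lambda>x. g x - dyadic q' b' x) \<le> \<delta> / 4"
    using assms(2) \<delta>4 by (rule dyadic_approxE)
  obtain c where c: "dyadic q b = dyadic (max q q') c"
    using dyadic_refine[of q "max q q'" b] by auto
  obtain c' where c': "dyadic q' b' = dyadic (max q q') c'"
    using dyadic_refine[of q' "max q q'" b'] by auto
  have "f x + g x - dyadic (max q q') (\<lambda>i. c i + c' i) x =
      (f x - dyadic q b x) + (g x - dyadic q' b' x)" for x
    unfolding c c' dyadic_add[symmetric] by (simp add: algebra_simps)
  then have eq: "(\<lambda>x. f x + g x - dyadic (max q q') (\<lambda>i. c i + c' i) x) =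
      (\<lambda>x. (f x - dyadic q b x) + (g x - dyadic q' b' x))"
    by blast
  have "sqn (\<lambda>x. f x + g x - dyadic (max q q') (\<lambda>i. c i + c' i) x) \<le> \<delta>"
    using sqn_add_le[OF L2_diff[OF L2(1) dyadic_L2] L2_diff[OF L2(2) dyadic_L2], of q b q' b'] b b'
    unfolding eq by simp
  then show "\<exists>q b. sqn (\<lambda>x. f x + g x - dyadic q b x) \<le> \<delta>" by blast
qed

lemma dyadic_approx_cmult:
  assumes "dyadic_approx f"
  shows "dyadic_approx (\<lambda>x. c * f x)"
  unfolding dyadic_approx_def
proof (intro conjI allI impI)
  show "L2 (\<lambda>x. c * f x)"
    using assms by (simp add: dyadic_approx_def L2_cmult)
  fix \<delta> :: real assume "\<delta> > 0"
  then have "\<delta> / ((cmod c)\<^sup>2 + 1) > 0"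
    by (simp add: add_nonneg_pos)
  then obtain q b where b: "sqn (\<lambda>x. f x - dyadic q b x) \<le> \<delta> / ((cmod c)\<^sup>2 + 1)"
    using assms unfolding dyadic_approx_def by blast
  have "sqn (\<lambda>x. c * f x - dyadic q (\<lambda>i. c * b i) x) = sqn (\<lambda>x. c * (f x - dyadic q b x))"
    by (simp only: dyadic_cmult[symmetric] right_diff_distrib)
  also have "\<dots> = (cmod c)\<^sup>2 * sqn (\<lambda>x. f x - dyadic q b x)"
    by (rule sqn_cmult)
  also have "\<dots> \<le> ((cmod c)\<^sup>2 + 1) * sqn (\<lambda>x. f x - dyadic q b x)"
    by (intro mult_right_mono) auto
  also have "\<dots> \<le> \<delta>"
    using b by (simp add: le_divide_eq add_nonneg_pos mult.commute)
  finally show "\<exists>q b. sqn (\<lambda>x. c * f x - dyadic q b x) \<le> \<delta>" by blast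
qed

lemma dyadic_approx_zero: "dyadic_approx (\<lambda>x. 0)"
  using dyadic_approx_cmult[OF dyadic_approx_dyadic, where c = 0] by simp

lemma dyadic_approx_sum:
  "(\<And>i. i \<in> I \<Longrightarrow> dyadic_approx (f i)) \<Longrightarrow> dyadic_approx (\<lambda>x. \<Sum>i\<in>I. f i x)"
  by (induction I rule: infinite_finite_induct) (auto intro: dyadic_approx_add dyadic_approx_zero)

text \<open>The ray is sampled at the left end points of the cells. A point x \<le> a gets the value
  1 on every grid, and a point x > a gets 0 as soon as the mesh is below x - a.\<close>

lemma dyadic_approx_atMost: "dyadic_approx (indicator ({..a} \<inter> {0..<1}))"
proof (rule dyadic_approx_dominated_limit)
  define s where "s q = dyadic q (\<lambda>i. indicator {..a} (real i / 2 ^ q))" for q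
  show "dyadic_approx (s q)" for q
    unfolding s_def by (rule dyadic_approx_dyadic)
  show "L2 (indicator ({..a} \<inter> {0..<1}))"
    by (rule L2_indicator[of _ 0 1]) auto
  show "L2 (indicator {0..<1})"
    by (rule L2_indicator[of _ 0 1]) auto
  fix x :: real
  have s_eq: "s q x = indicator {..a} (real_of_int \<lfloor>2 ^ q * x\<rfloor> / 2 ^ q)" if "x \<in> {0..<1}" for q
    using that by (simp add: s_def dyadic_eq)
  show "cmod (s q x) \<le> cmod (indicator {0..<1} x)" for q
  proof (cases "x \<in> {0..<1}")
    case True
    then show ?thesis by (simp add: s_eq) (simp add: indicator_def)
  next
    case False
    then show ?thesis by (simp add: s_def dyadic_outside)
  qed
  show "(\<lambda>q. s q x) \<longlonglongrightarrow> indicator ({..a} \<inter> {0..<1}) x"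
  proof (cases "x \<in> {0..<1}")
    case False
    then have "(\<lambda>q. s q x) = (\<lambda>q. 0)"
      by (simp add: s_def dyadic_outside)
    with False show ?thesis by (auto simp: indicator_def)
  next
    case x: True
    have lower: "real_of_int \<lfloor>2 ^ q * x\<rfloor> / 2 ^ q \<le> x" for q
      by (simp add: divide_le_eq mult.commute)
    have upper: "x - (1 / 2) ^ q < real_of_int \<lfloor>2 ^ q * x\<rfloor> / 2 ^ q" for q
    proof -
      have "2 ^ q * x - 1 < real_of_int \<lfloor>2 ^ q * x\<rfloor>"
        by linarith
      then show ?thesis by (simp add: less_divide_eq algebra_simps power_one_over)
    qed
    show ?thesis
    proof (cases "x \<le> a")
      case True
      then have "s q x = 1" for q
        using lower[of q] by (simp add: s_eq[OF x] indicator_def)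
      with True x show ?thesis by (simp add: indicator_def)
    next
      case False
      have "(\<lambda>q. (1 / 2) ^ q :: real) \<longlonglongrightarrow> 0"
        by (rule LIMSEQ_power_zero) simp
      then have "\<forall>\<^sub>F q in sequentially. (1 / 2 :: real) ^ q < x - a"
        using False by (intro order_tendstoD(2)) auto
      then have "\<forall>\<^sub>F q in sequentially. s q x = 0"
      proof eventually_elim
        case (elim q)
        then show ?case using upper[of q] by (simp add: s_eq[OF x] indicator_def)
      qed
      then have "(\<lambda>q. s q x) \<longlonglongrightarrow> 0"
        by (rule tendsto_eventually)
      with False show ?thesis by (simp add: indicator_def)
    qed
  qed
qed

text \<open>A pi-lambda argument: rays are stable under intersection and generate the Borel sets,
  and the sets whose trace on [0,1) is approximable are closed under complements and countable
  disjoint unions.\<close>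

lemma dyadic_approx_indicator:
  assumes "A \<in> sets borel"
  shows "dyadic_approx (indicator (A \<inter> {0..<1}))"
proof -
  have unit: "(indicator {0..<1} :: real \<Rightarrow> complex) = dyadic 0 (\<lambda>i. 1)"
    by (rule dyadic_cong) auto
  have sets: "sets (borel :: real measure) = sigma_sets UNIV (range (\<lambda>a. {..a}))"
    unfolding borel_eq_atMost by (simp add: sets_measure_of)
  have "Int_stable (range (\<lambda>a::real. {..a}))"
    by (auto simp: Int_stable_def)
  moreover have "range (\<lambda>a::real. {..a}) \<subseteq> Pow UNIV"
    by simp
  ultimately show ?thesis
    using assms[unfolded sets]
  proof (induction A rule: sigma_sets_induct_disjoint)
    case (basic A)
    then show ?case by (auto intro: dyadic_approx_atMost)
  next
    case empty
    then show ?case using dyadic_approx_zero by simp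
  next
    case (compl A)
    have "(indicator ((UNIV - A) \<inter> {0..<1}) :: real \<Rightarrow> complex) =
        (\<lambda>x. indicator {0..<1} x + (- 1) * indicator (A \<inter> {0..<1}) x)"
      by (auto simp: indicator_def)
    then show ?case
      using dyadic_approx_add[OF dyadic_approx_dyadic[of 0 "\<lambda>i. 1"] dyadic_approx_cmult[OF compl(2), of "-1"]]
      by (simp add: unit)
  next
    case (union A)
    have meas: "A i \<in> sets borel" for i
      using union(2) unfolding sets by auto
    show ?case
    proof (rule dyadic_approx_dominated_limit)
      let ?s = "\<lambda>n x. \<Sum>i<n. indicator (A i \<inter> {0..<1}) x :: complex"
      show "dyadic_approx (?s n)" for n
        by (rule dyadic_approx_sum) (rule union)
      show "L2 (indicator ((\<Union>i. A i) \<inter> {0..<1}))"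
        using meas by (intro L2_indicator[of _ 0 1]) auto
      show "L2 (indicator {0..<1})"
        by (rule L2_indicator[of _ 0 1]) auto
      fix x :: real
      have s_eq: "?s n x = indicator ((\<Union>i<n. A i) \<inter> {0..<1}) x" for n
      proof -
        have "disjoint_family_on (\<lambda>i. A i \<inter> {0..<1}) {..<n}"
          using union(1) by (auto simp: disjoint_family_on_def)
        then have "?s n x = indicator (\<Union>i<n. A i \<inter> {0..<1}) x"
          by (intro indicator_UN_disjoint[symmetric]) auto
        then show ?thesis by simp
      qed
      show "cmod (?s n x) \<le> cmod (indicator {0..<1} x)" for n
        unfolding s_eq by (auto simp: indicator_def)
      show "(\<lambda>n. ?s n x) \<longlonglongrightarrow> indicator ((\<Union>i. A i) \<inter> {0..<1}) x"
      proof (cases "x \<in> (\<Union>i. A i) \<inter> {0..<1}")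
        case True
        then obtain i where i: "x \<in> A i" by auto
        have "?s n x = 1" if "n > i" for n
          unfolding s_eq using True i that by (auto simp: indicator_def)
        then have "\<forall>\<^sub>F n in sequentially. ?s n x = 1"
          using eventually_gt_at_top[of i] by (rule eventually_mono[rotated]) 
        then have "(\<lambda>n. ?s n x) \<longlonglongrightarrow> 1"
          by (rule tendsto_eventually)
        with True show ?thesis by simp
      next
        case False
        then have "?s n x = 0" for n
          unfolding s_eq by (auto simp: indicator_def)
        then have "(\<lambda>n. ?s n x) = (\<lambda>n. 0)" by auto
        with False show ?thesis by simp
      qed
    qed
  qed
qed

text \<open>Simple functions converge to f pointwise with modulus at most 2|f|. This bound is the
  majorant, and it also forces them to vanish where f does, so that only the traces of their level
  sets on [0,1) matter.\<close>

lemma dyadic_dense: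
  assumes "L2 f" "\<And>x. x \<notin> {0..<1} \<Longrightarrow> f x = 0"
  shows "dyadic_approx f"
proof -
  have "f \<in> borel_measurable borel"
    using assms(1) by (rule L2_borel_measurable)
  then obtain F where F: "\<And>i. simple_function borel (F i)" "\<And>x. (\<lambda>i. F i x) \<longlonglongrightarrow> f x"
      "\<And>i x. dist (F i x) 0 \<le> 2 * dist (f x) 0"
    using borel_measurable_implies_sequence_metric[of f borel 0] by auto
  show ?thesis
  proof (rule dyadic_approx_dominated_limit[OF _ assms(1) L2_cmult[OF assms(1), of 2]])
    fix i
    have fin: "finite (range (F i))"
      using simple_functionD(1)[OF F(1)] by simp
    have F_eq: "F i = (\<lambda>x. \<Sum>y\<in>range (F i). y * indicator ((F i -` {y}) \<inter> {0..<1}) x)"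
    proof
      fix x
      show "F i x = (\<Sum>y\<in>range (F i). y * indicator ((F i -` {y}) \<inter> {0..<1}) x)"
      proof (cases "x \<in> {0..<1}")
        case True
        then have "(\<Sum>y\<in>range (F i). y * indicator ((F i -` {y}) \<inter> {0..<1}) x) =
            (\<Sum>y\<in>range (F i). if y = F i x then y else 0)"
          by (intro sum.cong) (auto simp: indicator_def)
        also have "\<dots> = F i x"
          using fin by simp
        finally show ?thesis by simp
      next
        case False
        then have "F i x = 0"
          using F(3)[of i x] assms(2)[of x] by simp
        with False show ?thesis by (auto simp: indicator_def)
      qed
    qed
    show "dyadic_approx (F i)"
    proof (subst F_eq, intro dyadic_approx_sum dyadic_approx_cmult dyadic_approx_indicator)
      fix y show "F i -` {y} \<in> sets borel"
        using simple_functionD(2)[OF F(1), of i "{y}"] by simp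
    qed
  qed (use F in \<open>auto simp: norm_mult\<close>)
qed

text \<open>The grid is fixed before w, and the error is measured against the norm of w: only a
  bound of this form can be applied to all cells of all f and then summed.\<close>

definition uniformly_dyadic :: "(real \<Rightarrow> complex) set \<Rightarrow> bool" where
  "uniformly_dyadic W \<longleftrightarrow>
     (\<forall>\<delta>>0. \<exists>q. \<forall>w\<in>W. \<exists>b. sqn (\<lambda>x. w x - dyadic q b x) \<le> \<delta> * sqn w)"

lemma uniformly_dyadicE:
  assumes "uniformly_dyadic W" "\<delta> > 0"
  obtains q where "\<And>w. w \<in> W \<Longrightarrow> \<exists>b. sqn (\<lambda>x. w x - dyadic q b x) \<le> \<delta> * sqn w"
  using assms unfolding uniformly_dyadic_def by blast

text \<open>An indexed family that may be linearly dependent. The intended generators are translates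
  of \<phi> cut to [0,1), and the two extreme ones are null, so no argument may rely on a
  basis.\<close>

definition finite_span :: "('i \<Rightarrow> real \<Rightarrow> complex) \<Rightarrow> 'i set \<Rightarrow> (real \<Rightarrow> complex) set" where
  "finite_span u F = {\<lambda>x. \<Sum>i\<in>F. c i * u i x | c. True}"

lemma finite_spanI: "(\<And>x. w x = (\<Sum>i\<in>F. c i * u i x)) \<Longrightarrow> w \<in> finite_span u F"
  unfolding finite_span_def by blast

lemma finite_span_L2: "(\<And>i. i \<in> F \<Longrightarrow> L2 (u i)) \<Longrightarrow> w \<in> finite_span u F \<Longrightarrow> L2 w"
  unfolding finite_span_def by (auto intro!: L2_sum L2_cmult)

lemma finite_span_cmult:
  assumes "w \<in> finite_span u F"
  shows "(\<lambda>x. a * w x) \<in> finite_span u F"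
proof -
  obtain c where "w = (\<lambda>x. \<Sum>i\<in>F. c i * u i x)"
    using assms by (auto simp: finite_span_def)
  then show ?thesis
    by (intro finite_spanI[where c = "\<lambda>i. a * c i"]) (simp add: sum_distrib_left mult.assoc)
qed

lemma finite_span_add:
  assumes "v \<in> finite_span u F" "w \<in> finite_span u F"
  shows "(\<lambda>x. v x + w x) \<in> finite_span u F"
proof -
  obtain c d where "v = (\<lambda>x. \<Sum>i\<in>F. c i * u i x)" "w = (\<lambda>x. \<Sum>i\<in>F. d i * u i x)"
    using assms by (auto simp: finite_span_def)
  then show ?thesis
    by (intro finite_spanI[where c = "\<lambda>i. c i + d i"]) (simp add: sum.distrib distrib_right)
qed

lemma finite_span_insertE:
  assumes "w \<in> finite_span u (insert j F)" "finite F" "j \<notin> F"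
  obtains c v where "v \<in> finite_span u F" "\<And>x. w x = v x + c * u j x"
proof -
  obtain c where "w = (\<lambda>x. \<Sum>i\<in>insert j F. c i * u i x)"
    using assms(1) by (auto simp: finite_span_def)
  then have "w x = (\<Sum>i\<in>F. c i * u i x) + c j * u j x" for x
    using assms by (simp add: add.commute)
  then show ?thesis
    by (intro that[of "\<lambda>x. \<Sum>i\<in>F. c i * u i x" "c j"]) (auto intro: finite_spanI)
qed

text \<open>Induction on the generators. If the new generator \<open>u j\<close> is an \<open>L\<^sup>2\<close> limit of the old span,
  a suitable element of the old span replaces it; otherwise its distance to the old span bounds both
  components of \<open>v + c u\<^sub>j\<close> by the norm of the sum.\<close>
lemma uniformly_dyadic_finite_span:
  assumes "finite F" "\<And>i. i \<in> F \<Longrightarrow> dyadic_approx (u i)"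
  shows "uniformly_dyadic (finite_span u F)"
  using assms
proof (induction F rule: finite_induct)
  case empty
  have "\<exists>b. sqn (\<lambda>x. w x - dyadic 0 b x) \<le> \<delta> * sqn w" if "w \<in> finite_span u {}" for w \<delta>
    using that by (intro exI[of _ "\<lambda>_. 0"]) (simp add: finite_span_def dyadic_def)
  then show ?case unfolding uniformly_dyadic_def by blast
next
  case (insert j F)
  let ?V = "finite_span u F"
  have IH: "uniformly_dyadic ?V"
    using insert by auto
  have uj: "L2 (u j)" and u_approx: "\<And>\<delta>. \<delta> > 0 \<Longrightarrow> \<exists>q b. sqn (\<lambda>x. u j x - dyadic q b x) \<le> \<delta>"
    using insert.prems[of j] by (auto simp: dyadic_approx_def)
  have V: "L2 v" if "v \<in> ?V" for v
    using finite_span_L2[OF _ that] insert.prems by (auto simp: dyadic_approx_def)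
  show ?case
  proof (cases "\<forall>e>0. \<exists>v\<in>?V. sqn (\<lambda>x. u j x - v x) \<le> e")
    case near: True
    show ?thesis unfolding uniformly_dyadic_def
    proof (intro allI impI)
      fix \<delta> :: real assume "\<delta> > 0"
      \<comment> \<open>The error is 2 \<eta> \<open>sqn w\<close> for passing from w to z, plus 2
        \<eta> \<open>sqn z\<close> for the step function, with \<open>sqn z\<close> at most 4
        \<open>sqn w\<close> because \<eta> \<le> 1: in total 10 \<eta>
        \<open>sqn w\<close>.\<close>
      define \<eta> where "\<eta> = min 1 (\<delta> / 10)"
      have \<eta>: "0 < \<eta>" "\<eta> \<le> 1" "10 * \<eta> \<le> \<delta>"
        using \<open>\<delta> > 0\<close> by (auto simp: \<eta>_def)
      obtain q where q: "\<And>v. v \<in> ?V \<Longrightarrow> \<exists>b. sqn (\<lambda>x. v x - dyadic q b x) \<le> \<eta> * sqn v"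
        using IH \<eta>(1) by (rule uniformly_dyadicE) blast
      show "\<exists>q. \<forall>w\<in>finite_span u (insert j F). \<exists>b. sqn (\<lambda>x. w x - dyadic q b x) \<le> \<delta> * sqn w"
      proof (intro exI[of _ q] ballI)
        fix w assume "w \<in> finite_span u (insert j F)"
        then obtain c v where v: "v \<in> ?V" and w: "\<And>x. w x = v x + c * u j x"
          using insert.hyps by (elim finite_span_insertE) auto
        have w_L2: "L2 w"
        proof -
          have "w = (\<lambda>x. v x + c * u j x)" using w by auto
          then show ?thesis using L2_add[OF V[OF v] L2_cmult[OF uj]] by simp
        qed
        \<comment> \<open>z replaces the multiple of \<open>u j\<close> in w by a multiple of a
          nearby element of the old span. A null w is treated apart, since the tolerance allowed to
          that element would be 0.\<close>
        obtain z where z: "z \<in> ?V" "sqn (\<lambda>x. w x - z x) \<le> \<eta> * sqn w"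
        proof (cases "sqn w = 0")
          case True
          have "(\<lambda>x. 0) \<in> ?V"
            by (rule finite_spanI[where c = "\<lambda>_. 0"]) simp
          then show ?thesis using True by (intro that[of "\<lambda>x. 0"]) auto
        next
          case False
          then have "sqn w > 0"
            using sqn_nonneg[of w] by linarith
          then have "\<eta> * sqn w / ((cmod c)\<^sup>2 + 1) > 0"
            using \<eta> by (simp add: add_nonneg_pos)
          then obtain y where y: "y \<in> ?V" "sqn (\<lambda>x. u j x - y x) \<le> \<eta> * sqn w / ((cmod c)\<^sup>2 + 1)"
            using near by blast
          have "(\<lambda>x. w x - (v x + c * y x)) = (\<lambda>x. c * (u j x - y x))"
            by (auto simp: w algebra_simps)
          then have "sqn (\<lambda>x. w x - (v x + c * y x)) = (cmod c)\<^sup>2 * sqn (\<lambda>x. u j x - y x)"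
            by (simp only: sqn_cmult)
          also have "\<dots> \<le> ((cmod c)\<^sup>2 + 1) * sqn (\<lambda>x. u j x - y x)"
            by (intro mult_right_mono) auto
          also have "\<dots> \<le> \<eta> * sqn w"
            using y(2) by (simp add: le_divide_eq add_nonneg_pos mult.commute)
          finally show ?thesis
            by (rule that[OF finite_span_add[OF v finite_span_cmult[OF y(1)]]])
        qed
        obtain b where b: "sqn (\<lambda>x. z x - dyadic q b x) \<le> \<eta> * sqn z"
          using q[OF z(1)] by blast
        have "sqn (\<lambda>x. z x - w x) \<le> \<eta> * sqn w"
          using z(2) by (subst sqn_minus_commute)
        also have "\<dots> \<le> sqn w"
          using \<eta> sqn_nonneg[of w] mult_right_mono[of \<eta> 1 "sqn w"] by simp
        finally have "sqn z \<le> 4 * sqn w"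
          using sqn_triangle[OF V[OF z(1)] w_L2 L2_zero] by simp
        then have "\<eta> * sqn z \<le> \<eta> * (4 * sqn w)"
          using \<eta> by (intro mult_left_mono) auto
        then have "sqn (\<lambda>x. w x - dyadic q b x) \<le> 10 * \<eta> * sqn w"
          using sqn_triangle[OF w_L2 V[OF z(1)] dyadic_L2[of q b]] z(2) b by linarith
        also have "\<dots> \<le> \<delta> * sqn w"
          using \<eta> by (intro mult_right_mono) auto
        finally show "\<exists>b. sqn (\<lambda>x. w x - dyadic q b x) \<le> \<delta> * sqn w" by blast
      qed
    qed
  next
    case False
    then obtain e where e: "e > 0" "\<And>v. v \<in> ?V \<Longrightarrow> e < sqn (\<lambda>x. u j x - v x)"
      by (auto simp: not_le)
    \<comment> \<open>For nonzero c the function -v/c lies in the old span, hence is at square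
      distance more than e from \<open>u j\<close>. So w controls its coefficient c, and through it
      also v.\<close>
    have coeff: "(cmod c)\<^sup>2 * e \<le> sqn (\<lambda>x. v x + c * u j x)" if "v \<in> ?V" for c v
    proof (cases "c = 0")
      case False
      have "(\<lambda>x. v x + c * u j x) = (\<lambda>x. c * (u j x - (- 1 / c) * v x))"
        using False by (auto simp: field_simps)
      then have "sqn (\<lambda>x. v x + c * u j x) = (cmod c)\<^sup>2 * sqn (\<lambda>x. u j x - (- 1 / c) * v x)"
        by (simp only: sqn_cmult)
      also have "\<dots> \<ge> (cmod c)\<^sup>2 * e"
        using e(2)[OF finite_span_cmult[OF that, of "-1 / c"]] by (intro mult_left_mono) auto
      finally show ?thesis .
    qed simp
    show ?thesis unfolding uniformly_dyadic_def
    proof (intro allI impI)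
      fix \<delta> :: real assume "\<delta> > 0"
      \<comment> \<open>C is the factor in \<open>sqn v \<le> C * sqn w\<close>, obtained from v = w
        - c \<open>u j\<close> and the bound on c. The tolerances \<delta>/(4C) for v and \<delta>
        e/4 for \<open>u j\<close> then each contribute \<delta>/2 times
        \<open>sqn w\<close>.\<close>
      define C where "C = 2 + 2 * sqn (u j) / e"
      have C: "C > 0"
        using e by (simp add: C_def add_pos_nonneg)
      have "\<delta> / (4 * C) > 0" "\<delta> * e / 4 > 0"
        using \<open>\<delta> > 0\<close> C e by auto
      obtain q where q: "\<And>v. v \<in> ?V \<Longrightarrow> \<exists>b. sqn (\<lambda>x. v x - dyadic q b x) \<le> \<delta> / (4 * C) * sqn v"
        using IH \<open>\<delta> / (4 * C) > 0\<close> by (rule uniformly_dyadicE) blast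
      obtain q' b' where b': "sqn (\<lambda>x. u j x - dyadic q' b' x) \<le> \<delta> * e / 4"
        using u_approx[OF \<open>\<delta> * e / 4 > 0\<close>] by blast
      obtain d' where d': "dyadic q' b' = dyadic (max q q') d'"
        using dyadic_refine[of q' "max q q'" b'] by auto
      show "\<exists>q. \<forall>w\<in>finite_span u (insert j F). \<exists>b. sqn (\<lambda>x. w x - dyadic q b x) \<le> \<delta> * sqn w"
      proof (intro exI[of _ "max q q'"] ballI)
        fix w assume "w \<in> finite_span u (insert j F)"
        then obtain c v where v: "v \<in> ?V" and w: "\<And>x. w x = v x + c * u j x"
          using insert.hyps by (elim finite_span_insertE) auto
        have w': "w = (\<lambda>x. v x + c * u j x)" using w by auto
        have w_L2: "L2 w"
          unfolding w' using L2_add[OF V[OF v] L2_cmult[OF uj]] .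
        have c_le: "(cmod c)\<^sup>2 * e \<le> sqn w"
          using coeff[OF v, of c] by (simp add: w')
        have v_le: "sqn v \<le> C * sqn w"
        proof -
          have "v = (\<lambda>x. w x - c * u j x)" by (auto simp: w)
          then have "sqn v \<le> 2 * sqn w + 2 * ((cmod c)\<^sup>2 * sqn (u j))"
            using sqn_diff_le[OF w_L2 L2_cmult[OF uj], of c] by (simp add: sqn_cmult)
          moreover have "(cmod c)\<^sup>2 * sqn (u j) \<le> sqn w / e * sqn (u j)"
            using c_le e by (intro mult_right_mono) (auto simp: le_divide_eq)
          moreover have "C * sqn w = 2 * sqn w + 2 * (sqn w / e * sqn (u j))"
            using e by (simp add: C_def field_simps)
          ultimately show ?thesis by linarith
        qed
        obtain b where b: "sqn (\<lambda>x. v x - dyadic q b x) \<le> \<delta> / (4 * C) * sqn v"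
          using q[OF v] by blast
        obtain d where d: "dyadic q b = dyadic (max q q') d"
          using dyadic_refine[of q "max q q'" b] by auto
        have eq: "(\<lambda>x. w x - dyadic (max q q') (\<lambda>i. d i + c * d' i) x) =
            (\<lambda>x. (v x - dyadic q b x) + c * (u j x - dyadic q' b' x))"
          unfolding d d' dyadic_add[symmetric] dyadic_cmult[symmetric] by (auto simp: w algebra_simps)
        have "sqn (\<lambda>x. w x - dyadic (max q q') (\<lambda>i. d i + c * d' i) x) \<le>
            2 * (\<delta> / (4 * C) * sqn v) + 2 * ((cmod c)\<^sup>2 * sqn (\<lambda>x. u j x - dyadic q' b' x))"
          using sqn_add_le[OF L2_diff[OF V[OF v] dyadic_L2] L2_cmult[OF L2_diff[OF uj dyadic_L2]], of q b c q' b'] b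
          unfolding eq by (simp add: sqn_cmult)
        also have "\<dots> \<le> 2 * (\<delta> / (4 * C) * (C * sqn w)) + 2 * ((cmod c)\<^sup>2 * (\<delta> * e / 4))"
          using b' v_le \<open>\<delta> > 0\<close> C by (intro add_mono mult_left_mono) auto
        also have "\<dots> \<le> \<delta> * sqn w"
          using C mult_left_mono[OF c_le, of "\<delta> / 2"] \<open>\<delta> > 0\<close> by (simp add: field_simps)
        finally show "\<exists>b. sqn (\<lambda>x. w x - dyadic (max q q') b x) \<le> \<delta> * sqn w" by blast
      qed
    qed
  qed
qed

text \<open>At each x at most the summand with j equal to the floor of M x is nonzero, so the
  squared modulus of the sum is the sum of the squared moduli pointwise; 1/M is the Jacobian of the
  rescaling.\<close>

lemma sqn_assemble:
  fixes v :: "nat \<Rightarrow> real \<Rightarrow> complex" and M :: nat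
  assumes "M > 0" "\<And>j. L2 (v j)" "\<And>j x. x \<notin> {0..<1} \<Longrightarrow> v j x = 0"
  shows "sqn (\<lambda>x. \<Sum>j<M. v j (real M * x - real j)) = (\<Sum>j<M. sqn (v j)) / real M"
proof -
  have zero: "v j (real M * x - real j) = 0" if "j \<noteq> nat \<lfloor>real M * x\<rfloor>" for j x
  proof (rule assms(3), rule notI)
    assume "real M * x - real j \<in> {0..<1}"
    then have "\<lfloor>real M * x\<rfloor> = int j"
      by (intro floor_unique) auto
    with that show False by simp
  qed
  have "(cmod (\<Sum>j<M. v j (real M * x - real j)))\<^sup>2 = (\<Sum>j<M. (cmod (v j (real M * x - real j)))\<^sup>2)" for x
  proof (cases "nat \<lfloor>real M * x\<rfloor> < M")
    case True
    then have "(\<Sum>j<M. g j (v j (real M * x - real j))) =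
        g (nat \<lfloor>real M * x\<rfloor>) (v (nat \<lfloor>real M * x\<rfloor>) (real M * x - real (nat \<lfloor>real M * x\<rfloor>)))"
      if "\<And>j. g j 0 = 0" for g :: "nat \<Rightarrow> complex \<Rightarrow> 'b :: real_normed_vector"
      using zero that by (subst sum.remove[of _ "nat \<lfloor>real M * x\<rfloor>"]) (auto intro!: sum.neutral)
    from this[of "\<lambda>_ z. z"] this[of "\<lambda>_ z. (cmod z)\<^sup>2"] show ?thesis by simp
  next
    case False
    then have "v j (real M * x - real j) = 0" if "j < M" for j
      using zero that by auto
    then show ?thesis by simp
  qed
  then have "sqn (\<lambda>x. \<Sum>j<M. v j (real M * x - real j)) =
      (LINT x|lborel. (\<Sum>j<M. (cmod (v j (real M * x - real j)))\<^sup>2))"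
    unfolding sqn_def by simp
  also have "\<dots> = (\<Sum>j<M. sqn (\<lambda>x. v j (real M * x - real j)))"
    unfolding sqn_def
    using L2_scale_shift[OF assms(2), THEN L2_integrable, of "real M"] assms(1)
    by (intro Bochner_Integration.integral_sum) auto
  also have "\<dots> = (\<Sum>j<M. sqn (v j)) / real M"
    using assms(1) by (simp add: sqn_scale_shift sum_divide_distrib)
  finally show ?thesis .
qed

text \<open>A cell index of the grid of mesh 2^-(R+q) splits by div and mod into the coarse cell and
  the position inside it.\<close>

lemma assemble_dyadic:
  "(\<lambda>x. \<Sum>j<2 ^ R. dyadic q (b j) (2 ^ R * x - real j)) =
     dyadic (R + q) (\<lambda>i. b (i div 2 ^ q) (i mod 2 ^ q))"
proof (rule dyadic_cong)
  have zero: "dyadic q (b j) (2 ^ R * x - real j) = 0" if "int j \<noteq> \<lfloor>2 ^ R * x\<rfloor>" for j x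
  proof (rule dyadic_outside, rule notI)
    assume "2 ^ R * x - real j \<in> {0..<1}"
    then have "\<lfloor>2 ^ R * x\<rfloor> = int j"
      by (intro floor_unique) auto
    with that show False by simp
  qed
  fix x :: real
  {
    assume x: "x \<in> {0..<1}"
    define k where "k = nat \<lfloor>2 ^ R * x\<rfloor>"
    have k: "int k = \<lfloor>2 ^ R * x\<rfloor>" "real k = real_of_int \<lfloor>2 ^ R * x\<rfloor>"
      using x by (auto simp: k_def)
    have in01: "2 ^ R * x - real k \<in> {0..<1}"
      unfolding k by (auto simp: of_int_floor_le) linarith
    have "\<lfloor>2 ^ q * (2 ^ R * x - real k)\<rfloor> = \<lfloor>2 ^ (R + q) * x\<rfloor> - 2 ^ q * int k"
    proof -
      have "2 ^ q * (2 ^ R * x - real k) = 2 ^ (R + q) * x - real_of_int (2 ^ q * int k)"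
        by (simp add: power_add algebra_simps)
      then show ?thesis by (simp only: floor_diff_of_int)
    qed
    also have "\<dots> = \<lfloor>2 ^ (R + q) * x\<rfloor> mod 2 ^ q"
      using minus_mult_div_eq_mod[of "\<lfloor>2 ^ (R + q) * x\<rfloor>" "2 ^ q"] by (simp add: k(1) floor_dyadic_div)
    finally have m: "nat \<lfloor>2 ^ q * (2 ^ R * x - real k)\<rfloor> = nat \<lfloor>2 ^ (R + q) * x\<rfloor> mod 2 ^ q"
      using x by (simp add: nat_mod_distrib nat_power_eq)
    have d: "nat \<lfloor>2 ^ (R + q) * x\<rfloor> div 2 ^ q = k"
      using x floor_dyadic_div[of R q x] unfolding k_def
      by (metis nat_div_distrib' nat_numeral nat_power_eq zero_le_numeral zero_le_power)
    have "(\<Sum>j<2 ^ R. dyadic q (b j) (2 ^ R * x - real j)) = dyadic q (b k) (2 ^ R * x - real k)"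
    proof -
      have "dyadic q (b j) (2 ^ R * x - real j) = 0" if "j \<noteq> k" for j
        by (rule zero) (use that k(1) in auto)
      then have "(\<Sum>j<2 ^ R. dyadic q (b j) (2 ^ R * x - real j)) =
          (\<Sum>j\<in>{k}. dyadic q (b j) (2 ^ R * x - real j))"
        using dyadic_floor_less[OF x, of R] by (intro sum.mono_neutral_right) (auto simp: k_def)
      then show ?thesis by simp
    qed
    then show "(\<Sum>j<2 ^ R. dyadic q (b j) (2 ^ R * x - real j)) =
        b (nat \<lfloor>2 ^ (R + q) * x\<rfloor> div 2 ^ q) (nat \<lfloor>2 ^ (R + q) * x\<rfloor> mod 2 ^ q)"
      using dyadic_eq[OF in01, of q "b k"] m d by simp
  next
    assume x: "x \<notin> {0..<1}"
    show "(\<Sum>j<2 ^ R. dyadic q (b j) (2 ^ R * x - real j)) = 0"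
    proof (intro sum.neutral ballI zero notI)
      fix j assume j: "j \<in> {..<2 ^ R}" and "int j = \<lfloor>2 ^ R * x\<rfloor>"
      then have "real j \<le> 2 ^ R * x" "2 ^ R * x < real j + 1"
        by linarith+
      moreover have "real j + 1 \<le> 2 ^ R"
        using j Suc_leI[of j "2 ^ R"] of_nat_mono[of "Suc j" "2 ^ R", where 'a = real] by simp
      ultimately have "0 \<le> 2 ^ R * x" "2 ^ R * x < 2 ^ R * 1"
        by linarith+
      with x show False
        using mult_le_cancel_left_pos[of "2 ^ R" 0 x] mult_less_cancel_left_pos[of "2 ^ R" x 1] by auto
    qed
  }
qed

section \<open>Samples at high frequencies\<close>

lemma has_vector_derivative_cis:
  "((\<lambda>x. cis (c * x)) has_vector_derivative (\<i> * of_real c * cis (c * x))) (at x within S)"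
  unfolding has_vector_derivative_def
  by (auto intro!: derivative_eq_intros simp: scaleR_conv_of_real algebra_simps)

text \<open>The factor c stays on the left, so the formula also covers c = 0. The half-open and the
  closed interval differ by a null set.\<close>

lemma mult_integral_cis:
  assumes "a \<le> b"
  shows "of_real c * (LINT x|lborel. indicator {a..<b} x * cis (c * x)) = - \<i> * (cis (c * b) - cis (c * a))"
proof -
  have "AE x in lborel. x \<noteq> b"
    by (rule AE_lborel_singleton)
  then have "(LINT x|lborel. indicator {a..<b} x * cis (c * x)) =
      (LINT x|lborel. indicator {a..b} x *\<^sub>R cis (c * x))"
  proof (intro integral_cong_AE)
    have [measurable]: "(\<lambda>x. cis (c * x)) \<in> borel_measurable borel"
      by (intro borel_measurable_continuous_onI continuous_intros)
    show "(\<lambda>x. indicator {a..<b} x * cis (c * x)) \<in> borel_measurable lborel"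
      "(\<lambda>x. indicat_real {a..b} x *\<^sub>R cis (c * x)) \<in> borel_measurable lborel"
      by measurable
  qed (auto simp: indicator_def elim!: eventually_mono)
  then have "\<i> * (of_real c * (LINT x|lborel. indicator {a..<b} x * cis (c * x))) =
      (LINT x|lborel. indicator {a..b} x *\<^sub>R (\<i> * of_real c * cis (c * x)))"
    by (simp add: mult.assoc flip: integral_mult_right_zero)
  also have "\<dots> = cis (c * b) - cis (c * a)"
    by (intro integral_FTC_Icc assms has_vector_derivative_cis continuous_intros)
  finally have "- \<i> * (\<i> * (of_real c * (LINT x|lborel. indicator {a..<b} x * cis (c * x)))) =
      - \<i> * (cis (c * b) - cis (c * a))" by simp
  then show ?thesis by (simp flip: mult.assoc)
qed

lemma dyadic_H_space: "dyadic q b \<in> H_space"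
  by (auto simp: H_space_def dyadic_L2 intro!: dyadic_outside)

lemma cis_int_period: "cis (t + 2 * pi * of_int j) = cis t"
  by (simp add: cis_mult[symmetric] cis_multiple_2pi)

text \<open>The product \<open>w f\<^sup>^(w)\<close> is, up to a constant, the Fourier transform of the derivative of \<open>f\<close>,
  which is a combination of point masses on the grid.\<close>
lemma dyadic_fourier_quasiperiodic:
  "of_real w * fourier (dyadic q b) w =
     of_real (w - 2 ^ q * of_int j) * fourier (dyadic q b) (w - 2 ^ q * of_int j)"
proof -
  define E :: "real \<Rightarrow> nat \<Rightarrow> complex" where
    "E = (\<lambda>w i. cis (- 2 * pi * w * ((real i + 1) / 2 ^ q)) - cis (- 2 * pi * w * (real i / 2 ^ q)))"
  have main: "of_real (- 2 * pi * w) * fourier (dyadic q b) w = (\<Sum>i<2 ^ q. b i * (- \<i> * E w i))" for w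
  proof -
    have int: "integrable lborel (\<lambda>x. indicator {real i / 2 ^ q..<(real i + 1) / 2 ^ q} x * cis (- 2 * pi * w * x))" for i
    proof (rule integrable_mult_cis[where c = "- 2 * pi * w"])
      have "integrable lborel (indicator {real i / 2 ^ q..<(real i + 1) / 2 ^ q} :: real \<Rightarrow> real)"
        by (rule integrable_real_indicator) (auto simp: divide_right_mono)
      then have "integrable lborel (\<lambda>x. complex_of_real (indicator {real i / 2 ^ q..<(real i + 1) / 2 ^ q} x))"
        by (rule integrable_of_real)
      moreover have "(\<lambda>x. complex_of_real (indicator {real i / 2 ^ q..<(real i + 1) / 2 ^ q} x)) =
          indicator {real i / 2 ^ q..<(real i + 1) / 2 ^ q}"
        by (rule ext) (simp add: indicator_def)
      ultimately show "integrable lborel (indicator {real i / 2 ^ q..<(real i + 1) / 2 ^ q} :: real \<Rightarrow> complex)"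
        by simp
    qed
    have "fourier (dyadic q b) w = (LINT x|lborel. (\<Sum>i<2 ^ q.
        b i * (indicator {real i / 2 ^ q..<(real i + 1) / 2 ^ q} x * cis (- 2 * pi * w * x))))"
      unfolding fourier_def dyadic_def sum_distrib_right by (simp only: mult.assoc)
    also have "\<dots> = (\<Sum>i<2 ^ q. b i *
        (LINT x|lborel. indicator {real i / 2 ^ q..<(real i + 1) / 2 ^ q} x * cis (- 2 * pi * w * x)))"
      using int by (subst Bochner_Integration.integral_sum) (auto intro: integrable_mult_right)
    finally have "of_real (- 2 * pi * w) * fourier (dyadic q b) w = (\<Sum>i<2 ^ q. b i *
        (of_real (- 2 * pi * w) * (LINT x|lborel. indicator {real i / 2 ^ q..<(real i + 1) / 2 ^ q} x * cis (- 2 * pi * w * x))))"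
      by (simp only: sum_distrib_left mult.left_commute)
    also have "\<dots> = (\<Sum>i<2 ^ q. b i * (- \<i> * E w i))"
      unfolding E_def by (subst mult_integral_cis) (auto simp: divide_right_mono)
    finally show ?thesis .
  qed
  \<comment> \<open>At a grid point i/2^q the frequency shift 2^q j changes the phase by 2 \<pi> i
    j. Both end points of every cell are grid points.\<close>
  have "cis (- 2 * pi * (w - 2 ^ q * of_int j) * (real i / 2 ^ q)) = cis (- 2 * pi * w * (real i / 2 ^ q))" for i
  proof -
    have "- 2 * pi * (w - 2 ^ q * of_int j) * (real i / 2 ^ q) =
        - 2 * pi * w * (real i / 2 ^ q) + 2 * pi * of_int (j * int i)"
      by (simp add: field_simps)
    then show ?thesis by (simp only: cis_int_period)
  qed
  from this[of "Suc _"] this have "E (w - 2 ^ q * of_int j) i = E w i" for i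
    unfolding E_def by (simp add: add.commute)
  then have "of_real (- 2 * pi * w) * fourier (dyadic q b) w =
      of_real (- 2 * pi * (w - 2 ^ q * of_int j)) * fourier (dyadic q b) (w - 2 ^ q * of_int j)"
    unfolding main by simp
  then have "of_real (- 2 * pi) * (of_real w * fourier (dyadic q b) w) =
      of_real (- 2 * pi) * (of_real (w - 2 ^ q * of_int j) * fourier (dyadic q b) (w - 2 ^ q * of_int j))"
    by (simp only: of_real_mult mult.assoc)
  then show ?thesis by (simp del: of_real_diff of_real_mult)
qed

section \<open>Consequences of the upper frame bound\<close>

lemma frame_bessel:
  assumes "fourier_frame \<omega> A B" "f \<in> H_space" "finite F"
  shows "(\<Sum>n\<in>F. (cmod (fourier f (\<omega> n)))\<^sup>2) \<le> B * sqn f"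
proof -
  have "(\<Sum>n\<in>F. (cmod (fourier f (\<omega> n)))\<^sup>2) \<le> (\<Sum>\<^sub>\<infinity>n. (cmod (fourier f (\<omega> n)))\<^sup>2)"
    using assms by (intro finite_sum_le_infsum) (auto simp: fourier_frame_def)
  also have "\<dots> \<le> B * sqn f"
    using assms by (auto simp: fourier_frame_def l2norm_power2)
  finally show ?thesis .
qed

text \<open>Since k + 1 \<le> 2k, each term is at most 2/k - 2/(k+1), and the sum
  telescopes.\<close>

lemma sum_inverse_squares_le:
  assumes "0 < K"
  shows "(\<Sum>k\<in>{K..<K + m}. 1 / (real k)\<^sup>2) \<le> 2 / real K"
proof -
  have "(\<Sum>k\<in>{K..<K + m}. 1 / (real k)\<^sup>2) \<le> (\<Sum>k\<in>{K..<K + m}. 2 / real k - 2 / real (Suc k))"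
  proof (rule sum_mono)
    fix k assume "k \<in> {K..<K + m}"
    then have "0 < k" using assms by auto
    then have "1 \<le> real k" by simp
    then have "real k * real (Suc k) \<le> 2 * (real k)\<^sup>2"
      using mult_left_mono[of 1 "real k" "real k"] by (simp add: power2_eq_square algebra_simps)
    then have "2 / (2 * (real k)\<^sup>2) \<le> 2 / (real k * real (Suc k))"
      using \<open>0 < k\<close> by (intro divide_left_mono) auto
    then have "1 / (real k)\<^sup>2 \<le> 2 / (real k * real (Suc k))"
      by simp
    also have "\<dots> = 2 / real k - 2 / real (Suc k)"
      using \<open>0 < k\<close> by (simp add: field_simps)
    finally show "1 / (real k)\<^sup>2 \<le> 2 / real k - 2 / real (Suc k)" .
  qed
  also have "\<dots> = 2 / real K - 2 / real (K + m)"
    by (induction m) auto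
  finally show ?thesis by (simp add: order_trans)
qed

lemma sum_inverse_squares_int_le:
  fixes J :: "int set"
  assumes "finite J" "0 < K" "\<And>j. j \<in> J \<Longrightarrow> int K \<le> \<bar>j\<bar>"
  shows "(\<Sum>j\<in>J. 1 / (real_of_int j)\<^sup>2) \<le> 4 / real K"
proof -
  obtain m where m: "nat ` abs ` J \<subseteq> {..<m}"
    using assms(1) finite_nat_iff_bounded by blast
  let ?I = "{K..<K + m}"
  have sub: "J \<subseteq> int ` ?I \<union> (\<lambda>k. - int k) ` ?I"
  proof
    fix j assume "j \<in> J"
    then have "nat \<bar>j\<bar> \<in> ?I"
      using m assms(3)[of j] by fastforce
    then show "j \<in> int ` ?I \<union> (\<lambda>k. - int k) ` ?I"
      by (cases "j \<ge> 0") (auto intro!: image_eqI[of _ _ "nat \<bar>j\<bar>"])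
  qed
  have "(\<Sum>j\<in>J. 1 / (real_of_int j)\<^sup>2) \<le> (\<Sum>j\<in>int ` ?I \<union> (\<lambda>k. - int k) ` ?I. 1 / (real_of_int j)\<^sup>2)"
    using sub by (intro sum_mono2) auto
  also have "\<dots> \<le> (\<Sum>j\<in>int ` ?I. 1 / (real_of_int j)\<^sup>2) + (\<Sum>j\<in>(\<lambda>k. - int k) ` ?I. 1 / (real_of_int j)\<^sup>2)"
    by (subst sum_Un) (auto intro!: sum_nonneg)
  also have "\<dots> = 2 * (\<Sum>k\<in>?I. 1 / (real k)\<^sup>2)"
    by (subst (1 2) sum.reindex) (auto simp: inj_on_def)
  also have "\<dots> \<le> 4 / real K"
    using sum_inverse_squares_le[OF assms(2), of m] by simp
  finally show ?thesis .
qed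

text \<open>Group the \<open>\<omega> n\<close> by the nearest multiple \<open>2\<^sup>q j\<close>: quasiperiodicity compares \<open>f\<^sup>^(\<omega> n)\<close> with the
  transform of a modulation of \<open>f\<close>, gaining the factor \<open>1 / \<bar>j\<bar>\<close>, and each group is controlled by
  the upper frame bound.\<close>
lemma dyadic_tail:
  assumes frame: "fourier_frame \<omega> A B" and "finite F" "0 < K"
    and far: "\<And>n. n \<in> F \<Longrightarrow> real K * 2 ^ q \<le> \<bar>\<omega> n\<bar>"
  shows "(\<Sum>n\<in>F. (cmod (fourier (dyadic q b) (\<omega> n)))\<^sup>2) \<le> 4 * B / real K * sqn (dyadic q b)"
proof -
  have B: "0 \<le> B" using frame by (auto simp: fourier_frame_def)
  define g where "g n = round (\<omega> n / 2 ^ q)" for n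
  let ?s = "dyadic q b"
  let ?m = "\<lambda>j x. ?s x * cis (2 * pi * (2 ^ q * of_int j) * x)"
  have g_large: "int K \<le> \<bar>g n\<bar>" if "n \<in> F" for n
  proof -
    have "real K \<le> \<bar>\<omega> n / 2 ^ q\<bar>"
      using far[OF that] by (simp add: le_divide_eq)
    \<comment> \<open>The half lost by rounding is recovered because \<open>g n\<close> is an
      integer.\<close>
    then have "real K - 1 / 2 \<le> \<bar>real_of_int (g n)\<bar>"
      using of_int_round_abs_le[of "\<omega> n / 2 ^ q"] unfolding g_def by linarith
    then show ?thesis by linarith
  qed
  have pointwise: "(cmod (fourier ?s (\<omega> n)))\<^sup>2 \<le> 1 / (real_of_int (g n))\<^sup>2 * (cmod (fourier (?m (g n)) (\<omega> n)))\<^sup>2"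
    if "n \<in> F" for n
  proof -
    define j where "j = g n"
    have j: "1 \<le> \<bar>real_of_int j\<bar>"
      using g_large[OF that] \<open>0 < K\<close> unfolding j_def by linarith
    have r: "\<bar>\<omega> n / 2 ^ q - of_int j\<bar> \<le> 1 / 2"
      using of_int_round_abs_le[of "\<omega> n / 2 ^ q"] unfolding j_def g_def by linarith
    have "\<omega> n - 2 ^ q * of_int j = 2 ^ q * (\<omega> n / 2 ^ q - of_int j)"
      by (simp add: right_diff_distrib)
    then have "\<bar>\<omega> n - 2 ^ q * of_int j\<bar> = 2 ^ q * \<bar>\<omega> n / 2 ^ q - of_int j\<bar>"
      by (simp only: abs_mult) simp
    also have "\<dots> \<le> 2 ^ q * (1 / 2)"
      using r by (intro mult_left_mono) auto
    finally have near: "\<bar>\<omega> n - 2 ^ q * of_int j\<bar> \<le> 2 ^ q / 2" by simp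
    \<comment> \<open>The rounding error 1/2 is at most |j|/2. So \<open>\<omega> n\<close> has
      modulus at least 2^q |j|/2, while after the shift it has modulus at most 2^q/2; the quotient
      is the gain 1/|j|.\<close>
    have "\<bar>real_of_int j\<bar> \<le> 2 * \<bar>\<omega> n / 2 ^ q\<bar>"
      using r j by linarith
    then have "2 ^ q * \<bar>real_of_int j\<bar> \<le> 2 ^ q * (2 * \<bar>\<omega> n / 2 ^ q\<bar>)"
      by (intro mult_left_mono) auto
    then have big: "2 ^ q * \<bar>real_of_int j\<bar> / 2 \<le> \<bar>\<omega> n\<bar>"
      by simp
    have "2 ^ q / 2 * (\<bar>real_of_int j\<bar> * cmod (fourier ?s (\<omega> n))) \<le> \<bar>\<omega> n\<bar> * cmod (fourier ?s (\<omega> n))"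
      using mult_right_mono[OF big, of "cmod (fourier ?s (\<omega> n))"] by simp
    also have "\<dots> = \<bar>\<omega> n - 2 ^ q * of_int j\<bar> * cmod (fourier ?s (\<omega> n - 2 ^ q * of_int j))"
      using arg_cong[OF dyadic_fourier_quasiperiodic[of "\<omega> n" q b j], of cmod]
      by (simp only: norm_mult norm_of_real)
    also have "\<dots> \<le> 2 ^ q / 2 * cmod (fourier ?s (\<omega> n - 2 ^ q * of_int j))"
      using near by (intro mult_right_mono) auto
    finally have "\<bar>real_of_int j\<bar> * cmod (fourier ?s (\<omega> n)) \<le> cmod (fourier (?m j) (\<omega> n))"
      unfolding fourier_mult_cis by simp
    then have "(\<bar>real_of_int j\<bar> * cmod (fourier ?s (\<omega> n)))\<^sup>2 \<le> (cmod (fourier (?m j) (\<omega> n)))\<^sup>2"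
      by (intro power_mono) auto
    then show ?thesis
      using j by (simp add: power_mult_distrib le_divide_eq j_def mult.commute)
  qed
  have "(\<Sum>n\<in>F. (cmod (fourier ?s (\<omega> n)))\<^sup>2) \<le>
      (\<Sum>n\<in>F. 1 / (real_of_int (g n))\<^sup>2 * (cmod (fourier (?m (g n)) (\<omega> n)))\<^sup>2)"
    by (intro sum_mono pointwise)
  also have "\<dots> = (\<Sum>j\<in>g ` F. \<Sum>n\<in>{n\<in>F. g n = j}. 1 / (real_of_int (g n))\<^sup>2 * (cmod (fourier (?m (g n)) (\<omega> n)))\<^sup>2)"
    using \<open>finite F\<close> by (rule sum.image_gen)
  also have "\<dots> = (\<Sum>j\<in>g ` F. 1 / (real_of_int j)\<^sup>2 * (\<Sum>n\<in>{n\<in>F. g n = j}. (cmod (fourier (?m j) (\<omega> n)))\<^sup>2))"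
    by (simp add: sum_distrib_left)
  also have "\<dots> \<le> (\<Sum>j\<in>g ` F. 1 / (real_of_int j)\<^sup>2 * (B * sqn ?s))"
  proof (intro sum_mono mult_left_mono)
    fix j
    have "?m j \<in> H_space"
      using H_space_mult_cis[OF dyadic_H_space] by simp
    then show "(\<Sum>n\<in>{n\<in>F. g n = j}. (cmod (fourier (?m j) (\<omega> n)))\<^sup>2) \<le> B * sqn ?s"
      using frame_bessel[OF frame, of "?m j" "{n\<in>F. g n = j}"] \<open>finite F\<close> by (simp only: sqn_mult_cis) simp
  qed simp
  also have "\<dots> = (\<Sum>j\<in>g ` F. 1 / (real_of_int j)\<^sup>2) * (B * sqn ?s)"
    by (simp only: sum_distrib_right)
  also have "\<dots> \<le> 4 / real K * (B * sqn ?s)"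
    using \<open>finite F\<close> \<open>0 < K\<close> g_large B
    by (intro mult_right_mono sum_inverse_squares_int_le) auto
  finally show ?thesis by simp
qed

lemma cmod_cis_minus_one_le: "cmod (cis t - 1) \<le> \<bar>t\<bar>"
proof -
  have "norm (cis t - cis 0) \<le> 1 * norm (t - 0)"
  proof (rule differentiable_bound[of UNIV cis "\<lambda>x t. t *\<^sub>R (\<i> * cis x)"])
    show "onorm (\<lambda>t. t *\<^sub>R (\<i> * cis x)) \<le> 1" for x
      by (rule onorm_le) (simp add: norm_mult)
  qed (auto intro!: derivative_eq_intros)
  then show ?thesis by simp
qed

text \<open>Test the upper frame bound on the indicator of \<open>[0, s)\<close> with \<open>s = 1 / (4 \<pi> L)\<close>, whose transform
  is at least \<open>s / 2\<close> on \<open>[-L, L]\<close>.\<close>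
lemma frame_count:
  assumes frame: "fourier_frame \<omega> A B" and "finite F" "1 \<le> L" "\<And>n. n \<in> F \<Longrightarrow> \<bar>\<omega> n\<bar> \<le> L"
  shows "real (card F) \<le> 16 * pi * B * L"
proof -
  \<comment> \<open>For |w| \<le> L and x in [0,s) the phase 2 \<pi> w x has modulus at most 1/2, so
    the transform at w differs from s by at most s/2. The condition 1 \<le> L keeps [0,s) inside
    [0,1].\<close>
  define s where "s = 1 / (4 * pi * L)"
  have piL: "0 < pi * L" using assms by simp
  have s: "0 < s" "2 * pi * L * s = 1 / 2" "s \<le> 1"
  proof -
    have "1 * 1 \<le> pi * L" 
      using assms(3) pi_ge_two by (intro mult_mono) auto
    then have "1 \<le> 4 * pi * L" by linarith
    then show "s \<le> 1"
      unfolding s_def using assms(3) by (subst divide_le_eq_1_pos) (auto intro!: mult_pos_pos)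
  qed (use piL assms in \<open>auto simp: s_def\<close>)
  let ?h = "indicator {0..<s} :: real \<Rightarrow> complex"
  have h: "?h \<in> H_space"
    using s(1,3) by (auto simp: H_space_def intro!: L2_indicator[of _ 0 1])
  have sqn_h: "sqn ?h = s"
  proof -
    have "(\<lambda>x. (cmod (?h x))\<^sup>2) = indicat_real {0..<s}" by (auto simp: indicator_def)
    then show ?thesis using s(1) by (simp add: sqn_def)
  qed
  have h_hat: "s / 2 \<le> cmod (fourier ?h w)" if "\<bar>w\<bar> \<le> L" for w
  proof -
    have int_h: "integrable lborel ?h"
      by (rule H_space_integrable[OF h])
    have int_s: "(LINT x|lborel. ?h x) = of_real s"
    proof -
      have "?h = (\<lambda>x. of_real (indicat_real {0..<s} x))" by (auto simp: indicator_def)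
      then show ?thesis using s(1) by simp
    qed
    have "fourier ?h w - of_real s = (LINT x|lborel. ?h x * cis (- 2 * pi * w * x) - ?h x)"
      unfolding fourier_def int_s[symmetric]
      by (rule Bochner_Integration.integral_diff[symmetric, OF fourier_integrable[OF h] int_h])
    also have "cmod \<dots> \<le> (LINT x|lborel. (1 / 2) * indicat_real {0..<s} x)"
    proof (rule Bochner_Integration.integral_norm_bound_integral)
      show "integrable lborel (\<lambda>x. ?h x * cis (- 2 * pi * w * x) - ?h x)"
        by (rule Bochner_Integration.integrable_diff[OF fourier_integrable[OF h] int_h])
      show "integrable lborel (\<lambda>x. (1 / 2) * indicat_real {0..<s} x)"
        using s(1) by (intro integrable_mult_right integrable_real_indicator) auto
      fix x
      show "cmod (?h x * cis (- 2 * pi * w * x) - ?h x) \<le> (1 / 2) * indicat_real {0..<s} x"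
      proof (cases "x \<in> {0..<s}")
        case True
        have "\<bar>w\<bar> * \<bar>x\<bar> \<le> L * s"
          using True that by (intro mult_mono) auto
        then have "2 * pi * (\<bar>w\<bar> * \<bar>x\<bar>) \<le> 2 * pi * (L * s)"
          by (intro mult_left_mono) auto
        moreover have "\<bar>- 2 * pi * w * x\<bar> = 2 * pi * (\<bar>w\<bar> * \<bar>x\<bar>)"
          by (simp add: abs_mult)
        moreover have "2 * pi * (L * s) = 1 / 2"
          using s(2) by (simp only: mult.assoc)
        ultimately have "\<bar>- 2 * pi * w * x\<bar> \<le> 1 / 2"
          by linarith
        with cmod_cis_minus_one_le have "cmod (cis (- 2 * pi * w * x) - 1) \<le> 1 / 2"
          by (rule order_trans)
        with True show ?thesis by (simp del: mult_minus_left)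
      qed simp
    qed
    also have "\<dots> = s / 2" using s(1) by simp
    finally show ?thesis
      using norm_triangle_ineq2[of "of_real s" "fourier ?h w"] s(1)
      by (simp add: norm_minus_commute)
  qed
  \<comment> \<open>Each sample contributes at least s^2/4 and the total is at most B s, so there
    are at most 4B/s = 16 \<pi> B L of them.\<close>
  have "real (card F) * (s / 2)\<^sup>2 = (\<Sum>n\<in>F. (s / 2)\<^sup>2)" by simp
  also have "\<dots> \<le> (\<Sum>n\<in>F. (cmod (fourier ?h (\<omega> n)))\<^sup>2)"
    using h_hat assms(4) s(1) by (intro sum_mono power_mono) auto
  also have "\<dots> \<le> B * s"
    using frame_bessel[OF frame h \<open>finite F\<close>] by (simp add: sqn_h)
  finally have "real (card F) * s \<le> 4 * B"
    using s(1) by (simp add: power2_eq_square)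
  then show ?thesis
    using piL by (simp add: s_def divide_le_eq mult_ac)
qed

text \<open>By monotonicity, if both \<open>\<omega> 0\<close> and \<open>\<omega> n\<close> lay in
  [-L, L], so would all values at indices between 0 and n. These are at least N + 2 indices, more
  than \<open>frame_count\<close> allows.\<close>

lemma frame_escape:
  assumes "fourier_frame \<omega> A B" "mono \<omega>" "1 \<le> L" "\<bar>\<omega> 0\<bar> \<le> L" "16 * pi * B * L \<le> real N"
    and n: "int N < \<bar>n\<bar>"
  shows "L \<le> \<bar>\<omega> n\<bar>"
proof (rule ccontr)
  assume "\<not> L \<le> \<bar>\<omega> n\<bar>"
  then have L: "\<bar>\<omega> n\<bar> \<le> L" by simp
  define F where "F = {min 0 n..max 0 n}"
  have "\<bar>\<omega> i\<bar> \<le> L" if "i \<in> F" for i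
  proof -
    have "\<omega> (min 0 n) \<le> \<omega> i" "\<omega> i \<le> \<omega> (max 0 n)"
      using that assms(2) by (auto simp: F_def intro: monoD)
    then show ?thesis
      using L assms(4) by (auto simp: min_def max_def split: if_splits)
  qed
  then have "real (card F) \<le> real N"
    using frame_count[OF assms(1) _ assms(3), of F] assms(5) by (simp add: F_def)
  then show False
    using n by (simp add: F_def min_def max_def split: if_splits)
qed

section \<open>Combinations of translates\<close>

text \<open>Only values on [0,1] are prescribed, because edge functions agree with combinations of
  translates only there, and periodic and folded functions with finite ones. The index window
  contains every translate that is nonzero somewhere on [0,1].\<close>

definition unit_comb :: "(real \<Rightarrow> complex) \<Rightarrow> nat \<Rightarrow> nat \<Rightarrow> (real \<Rightarrow> complex) \<Rightarrow> bool" where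
  "unit_comb \<phi> p R f \<longleftrightarrow>
     (\<exists>d :: int \<Rightarrow> complex. \<forall>x\<in>{0..1}. f x = (\<Sum>n\<in>{- int p..2 ^ R + int p}. d n * \<phi> (2 ^ R * x - of_int n)))"

definition shift_comb :: "(real \<Rightarrow> complex) \<Rightarrow> nat \<Rightarrow> nat \<Rightarrow> (real \<Rightarrow> complex) \<Rightarrow> bool" where
  "shift_comb \<phi> p R f \<longleftrightarrow> (\<forall>x. x \<notin> {0..1} \<longrightarrow> f x = 0) \<and> unit_comb \<phi> p R f"

lemma shift_comb_H_space:
  assumes "L2 \<phi>" "shift_comb \<phi> p R f"
  shows "f \<in> H_space"
proof -
  obtain d where d: "\<And>x. x \<in> {0..1} \<Longrightarrow> f x = (\<Sum>n\<in>{- int p..2 ^ R + int p}. d n * \<phi> (2 ^ R * x - of_int n))"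
    and f0: "\<And>x. x \<notin> {0..1} \<Longrightarrow> f x = 0"
    using assms(2) unfolding shift_comb_def unit_comb_def by blast
  have "f = (\<lambda>x. (\<Sum>n\<in>{- int p..2 ^ R + int p}. d n * \<phi> (2 ^ R * x - of_int n)) * indicator {0..1} x)"
    using d f0 by (auto simp: indicator_def)
  moreover have "L2 (\<lambda>x. (\<Sum>n\<in>{- int p..2 ^ R + int p}. d n * \<phi> (2 ^ R * x - of_int n)) * indicator {0..1} x)"
    using assms(1) by (intro L2_indicator_mult L2_sum L2_cmult L2_scale_shift) auto
  ultimately show ?thesis using f0 by (auto simp: H_space_def)
qed

text \<open>On the cell j only translates with |n - j| \<le> p can be nonzero. Writing n = m + j
  moves j, R and f into the coefficients, so the span is the same for all of them.\<close>

lemma shift_comb_piece: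
  assumes supp: "\<forall>x. x \<notin> {- real p + 1..real p} \<longrightarrow> \<phi> x = 0"
    and f: "shift_comb \<phi> p R f" and j: "j < 2 ^ R"
  shows "(\<lambda>y. f ((y + real j) / 2 ^ R) * indicator {0..<1} y) \<in>
    finite_span (\<lambda>n y. \<phi> (y - of_int n) * indicator {0..<1} y) {- int p..int p}"
proof -
  obtain d where d: "\<And>x. x \<in> {0..1} \<Longrightarrow> f x = (\<Sum>n\<in>{- int p..2 ^ R + int p}. d n * \<phi> (2 ^ R * x - of_int n))"
    using f unfolding shift_comb_def unit_comb_def by blast
  have j': "real j + 1 \<le> 2 ^ R"
    using j Suc_leI[of j "2 ^ R"] of_nat_mono[of "Suc j" "2 ^ R", where 'a = real] by simp
  have "int j < 2 ^ R"
    using j by (metis of_nat_less_iff of_nat_numeral of_nat_power)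
  have "f ((y + real j) / 2 ^ R) = (\<Sum>m\<in>{- int p..int p}. d (m + int j) * \<phi> (y - of_int m))"
    if y: "y \<in> {0..<1}" for y
  proof -
    have "(y + real j) / 2 ^ R \<in> {0..1}"
      using y j' by auto
    then have "f ((y + real j) / 2 ^ R) =
        (\<Sum>n\<in>{- int p..2 ^ R + int p}. d n * \<phi> (y + real j - of_int n))"
      using d by simp
    also have "\<dots> = (\<Sum>n\<in>(\<lambda>m. m + int j) ` {- int p..int p}. d n * \<phi> (y + real j - of_int n))"
    proof (rule sum.mono_neutral_right)
      show "(\<lambda>m. m + int j) ` {- int p..int p} \<subseteq> {- int p..2 ^ R + int p}"
        using \<open>int j < 2 ^ R\<close> by auto
      show "\<forall>n\<in>{- int p..2 ^ R + int p} - (\<lambda>m. m + int j) ` {- int p..int p}.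
          d n * \<phi> (y + real j - of_int n) = 0"
      proof
        fix n assume "n \<in> {- int p..2 ^ R + int p} - (\<lambda>m. m + int j) ` {- int p..int p}"
        then have "n - int j \<notin> {- int p..int p}"
          by (metis DiffD2 diff_add_cancel image_eqI)
        then have "n < int j - int p \<or> int j + int p < n" by auto
        then have "real_of_int n + 1 \<le> real j - real p \<or> real j + real p + 1 \<le> real_of_int n"
          by linarith
        then have "y + real j - of_int n \<notin> {- real p + 1..real p}"
          using y by auto
        then show "d n * \<phi> (y + real j - of_int n) = 0"
          using supp by simp
      qed
    qed simp
    also have "\<dots> = (\<Sum>m\<in>{- int p..int p}. d (m + int j) * \<phi> (y - of_int m))"
      by (subst sum.reindex) (auto simp: inj_on_def)
    finally show ?thesis .
  qed
  then show ?thesis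
    by (intro finite_spanI[where c = "\<lambda>m. d (m + int j)"]) (auto simp: indicator_def)
qed

text \<open>The constant is chosen before N, R, f and F. Here f is split into a step function g and
  a remainder r: r is small in norm, and g has little energy at high frequencies.\<close>

lemma shift_comb_tail:
  assumes frame: "fourier_frame \<omega> A B" and mono: "mono \<omega>" and \<phi>: "L2 \<phi>"
    and supp: "\<forall>x. x \<notin> {- real p + 1..real p} \<longrightarrow> \<phi> x = 0" and "0 < \<epsilon>"
  obtains c0 where "\<And>N R f F. c0 * 2 ^ R \<le> real N \<Longrightarrow> shift_comb \<phi> p R f \<Longrightarrow> finite F \<Longrightarrow>
      (\<And>n. n \<in> F \<Longrightarrow> int N < \<bar>n\<bar>) \<Longrightarrow> (\<Sum>n\<in>F. (cmod (fourier f (\<omega> n)))\<^sup>2) \<le> \<epsilon> * sqn f"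
proof -
  have B: "0 < B"
    using frame by (auto simp: fourier_frame_def)
  let ?W = "finite_span (\<lambda>n y. \<phi> (y - of_int n) * indicator {0..<1} y) {- int p..int p}"
  \<comment> \<open>The remainder contributes 2 B \<delta> and the step function 32 B/K, each times
    \<open>sqn f\<close>; both are kept below \<epsilon>/2. The bound \<delta> \<le> 1 serves to
    compare the norm of g with that of f.\<close>
  define \<delta> where "\<delta> = min 1 (\<epsilon> / (4 * B))"
  have \<delta>: "0 < \<delta>" "\<delta> \<le> 1" "4 * B * \<delta> \<le> \<epsilon>"
  proof -
    have "4 * B * \<delta> \<le> 4 * B * (\<epsilon> / (4 * B))"
      unfolding \<delta>_def using B by (intro mult_left_mono) auto
    then show "4 * B * \<delta> \<le> \<epsilon>" using B by simp
  qed (use B \<open>0 < \<epsilon>\<close> in \<open>auto simp: \<delta>_def\<close>)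
  have "uniformly_dyadic ?W"
    using \<phi> by (intro uniformly_dyadic_finite_span dyadic_dense L2_indicator_mult L2_shift) auto
  then obtain q where q: "\<And>w. w \<in> ?W \<Longrightarrow> \<exists>b. sqn (\<lambda>x. w x - dyadic q b x) \<le> \<delta> * sqn w"
    using \<delta>(1) by (rule uniformly_dyadicE) blast
  \<comment> \<open>Besides the \<epsilon>/2 for the step function, K dominates 1 and
    \<open>\<omega> 0\<close>, as \<open>frame_escape\<close> will require.\<close>
  obtain K :: nat where K: "max (64 * B / \<epsilon>) (max \<bar>\<omega> 0\<bar> 1) \<le> real K"
    using real_arch_simple by blast
  have K_pos: "0 < K" and K_\<epsilon>: "64 * B \<le> \<epsilon> * real K" and K0: "\<bar>\<omega> 0\<bar> \<le> real K"
    using K \<open>0 < \<epsilon>\<close> by (auto simp: divide_le_eq mult.commute)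
  show ?thesis
  proof (rule that[of "16 * pi * B * (real K * 2 ^ q)"])
    fix N R f F
    assume N: "16 * pi * B * (real K * 2 ^ q) * 2 ^ R \<le> real N"
      and f: "shift_comb \<phi> p R f" and F: "finite F" and far: "\<And>n. n \<in> F \<Longrightarrow> int N < \<bar>n\<bar>"
    have f_H: "f \<in> H_space"
      by (rule shift_comb_H_space[OF \<phi> f])
    then have f_L2: "L2 f" by (simp add: H_space_def)
    define v where "v j y = f ((y + real j) / 2 ^ R) * indicator {0..<1} y" for j y
    have "\<exists>b. sqn (\<lambda>x. v j x - dyadic q b x) \<le> \<delta> * sqn (v j)" if "j < 2 ^ R" for j
    proof -
      have "v j \<in> ?W"
        using shift_comb_piece[OF supp f that] by (simp add: v_def[abs_def])
      then show ?thesis by (rule q)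
    qed
    then obtain b where b: "\<And>j. j < 2 ^ R \<Longrightarrow> sqn (\<lambda>x. v j x - dyadic q (b j) x) \<le> \<delta> * sqn (v j)"
      by metis
    define g where "g x = (\<Sum>j<2 ^ R. dyadic q (b j) (2 ^ R * x - real j))" for x
    obtain b' where g_dyadic: "g = dyadic (R + q) b'"
      using assemble_dyadic[of q b R] unfolding g_def[abs_def] by blast
    have g_H: "g \<in> H_space"
      unfolding g_dyadic by (rule dyadic_H_space)
    then have g_L2: "L2 g" by (simp add: H_space_def)
    define r where "r x = f x - g x" for x
    have r_H: "r \<in> H_space"
      unfolding r_def by (rule H_space_diff[OF f_H g_H])
    then have r_L2: "L2 r" by (simp add: H_space_def)
    have v_L2: "L2 (v j)" for j
    proof -
      have "L2 (\<lambda>y. f (real j / 2 ^ R + 1 / 2 ^ R * y))"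
        using f_L2 by (rule L2_affine) simp
      then show ?thesis
        unfolding v_def by (intro L2_indicator_mult) (auto simp: add_divide_distrib add.commute)
    qed
    \<comment> \<open>The half-open cells miss the point 1, where f may be nonzero; this costs only
      a null set.\<close>
    have f_eq: "f x = (\<Sum>j<2 ^ R. v j (2 ^ R * x - real j))" if "x \<noteq> 1" for x
    proof -
      have "v j (2 ^ R * x - real j) = f x * indicator {real j / 2 ^ R..<(real j + 1) / 2 ^ R} x" for j
        by (auto simp: v_def indicator_def field_simps)
      then have "(\<Sum>j<2 ^ R. v j (2 ^ R * x - real j)) = f x * dyadic R (\<lambda>_. 1) x"
        by (simp only: dyadic_def sum_distrib_left mult_1)
      moreover have "f x = 0" if "x \<notin> {0..<1}"
        using that \<open>x \<noteq> 1\<close> f_H by (auto simp: H_space_def)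
      ultimately show ?thesis
        by (cases "x \<in> {0..<1}") (auto simp: dyadic_eq)
    qed
    have AE1: "AE x in lborel. x \<noteq> (1::real)"
      by (rule AE_lborel_singleton)
    note assemble = sqn_assemble[of "2 ^ R", simplified]
    have f_sqn: "sqn f = (\<Sum>j<2 ^ R. sqn (v j)) / 2 ^ R"
    proof -
      have "sqn f = sqn (\<lambda>x. \<Sum>j<2 ^ R. v j (2 ^ R * x - real j))"
        using AE1 f_eq v_L2
        by (intro sqn_cong_AE f_L2 L2_sum L2_scale_shift) (auto elim!: eventually_mono)
      also have "\<dots> = (\<Sum>j<2 ^ R. sqn (v j)) / 2 ^ R"
        by (rule assemble[OF v_L2]) (auto simp: v_def)
      finally show ?thesis .
    qed
    have "sqn r = sqn (\<lambda>x. \<Sum>j<2 ^ R. v j (2 ^ R * x - real j) - dyadic q (b j) (2 ^ R * x - real j))"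
    proof (rule sqn_cong_AE[OF r_L2])
      show "L2 (\<lambda>x. \<Sum>j<2 ^ R. v j (2 ^ R * x - real j) - dyadic q (b j) (2 ^ R * x - real j))"
        by (intro L2_sum L2_diff L2_scale_shift[of "v _"] L2_scale_shift[of "dyadic q _"] v_L2 dyadic_L2) auto
      show "AE x in lborel. r x = (\<Sum>j<2 ^ R. v j (2 ^ R * x - real j) - dyadic q (b j) (2 ^ R * x - real j))"
        using AE1 by eventually_elim (simp add: r_def g_def f_eq sum_subtractf)
    qed
    also have "\<dots> = (\<Sum>j<2 ^ R. sqn (\<lambda>x. v j x - dyadic q (b j) x)) / 2 ^ R"
      by (rule assemble[OF L2_diff[OF v_L2 dyadic_L2]]) (simp add: v_def dyadic_outside)
    also have "\<dots> \<le> (\<Sum>j<2 ^ R. \<delta> * sqn (v j)) / 2 ^ R"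
      using b by (intro divide_right_mono sum_mono) auto
    also have "\<dots> = \<delta> * sqn f"
      unfolding f_sqn by (simp add: sum_distrib_left)
    finally have r_le: "sqn r \<le> \<delta> * sqn f" .
    have g_le: "sqn g \<le> 4 * sqn f"
    proof -
      have "g = (\<lambda>x. f x - r x)" by (auto simp: r_def)
      then have "sqn g \<le> 2 * sqn f + 2 * sqn r"
        using sqn_diff_le[OF f_L2 r_L2] by simp
      moreover have "\<delta> * sqn f \<le> 1 * sqn f"
        using \<delta> by (intro mult_right_mono) auto
      ultimately show ?thesis using r_le by linarith
    qed
    \<comment> \<open>The step function g lives on the grid of mesh 2^-(R+q), so K 2^(R+q) is the
      threshold beyond which \<open>dyadic_tail\<close> applies; the choice of the constant makes N
      large enough for it.\<close>
    have escape: "real K * 2 ^ (R + q) \<le> \<bar>\<omega> n\<bar>" if "n \<in> F" for n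
    proof (rule frame_escape[OF frame mono _ _ _ far[OF that]])
      have "real K * 1 \<le> real K * 2 ^ (R + q)"
        by (intro mult_left_mono) auto
      then show "1 \<le> real K * 2 ^ (R + q)" "\<bar>\<omega> 0\<bar> \<le> real K * 2 ^ (R + q)"
        using K_pos K0 by linarith+
      show "16 * pi * B * (real K * 2 ^ (R + q)) \<le> real N"
        using N by (simp add: power_add mult_ac)
    qed
    have "(\<Sum>n\<in>F. (cmod (fourier f (\<omega> n)))\<^sup>2) \<le>
        (\<Sum>n\<in>F. 2 * (cmod (fourier r (\<omega> n)))\<^sup>2 + 2 * (cmod (fourier g (\<omega> n)))\<^sup>2)"
    proof (rule sum_mono)
      fix n
      have "fourier f (\<omega> n) = fourier r (\<omega> n) + fourier g (\<omega> n)"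
        using fourier_add[OF r_H g_H, of "\<omega> n"] by (simp add: r_def)
      then show "(cmod (fourier f (\<omega> n)))\<^sup>2 \<le> 2 * (cmod (fourier r (\<omega> n)))\<^sup>2 + 2 * (cmod (fourier g (\<omega> n)))\<^sup>2"
        by (simp only: cmod_add_sq_le)
    qed
    also have "\<dots> = 2 * (\<Sum>n\<in>F. (cmod (fourier r (\<omega> n)))\<^sup>2) + 2 * (\<Sum>n\<in>F. (cmod (fourier g (\<omega> n)))\<^sup>2)"
      by (simp add: sum.distrib sum_distrib_left)
    also have "\<dots> \<le> 2 * (B * sqn r) + 2 * (4 * B / real K * sqn g)"
      using frame_bessel[OF frame r_H F] dyadic_tail[OF frame F K_pos escape, of b'] g_dyadic
      by simp
    also have "\<dots> \<le> 2 * (B * (\<delta> * sqn f)) + 2 * (4 * B / real K * (4 * sqn f))"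
      using r_le g_le B by (intro add_mono mult_left_mono) auto
    also have "\<dots> = (4 * B * \<delta> + 64 * B / real K) / 2 * sqn f"
      by (simp add: algebra_simps)
    also have "\<dots> \<le> \<epsilon> * sqn f"
    proof -
      have "64 * B / real K \<le> \<epsilon>"
        using K_\<epsilon> K_pos by (simp add: divide_le_eq)
      then show ?thesis using \<delta>(3) by (intro mult_right_mono) auto
    qed
    finally show "(\<Sum>n\<in>F. (cmod (fourier f (\<omega> n)))\<^sup>2) \<le> \<epsilon> * sqn f" .
  qed
qed

text \<open>Removing a tail of at most \<epsilon> \<open>sqn f\<close> from the lower frame
  inequality leaves A - \<epsilon> for the Rayleigh quotients on T, and the upper inequality bounds
  all quotients by B. Bounding finite parts of the tail suffices since its terms are nonnegative. A
  non-null element makes the sets under \<open>Inf\<close> and \<open>Sup\<close> nonempty.\<close>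

lemma Cconst_le:
  assumes frame: "fourier_frame \<omega> A B" and "\<epsilon> < A" and T: "T \<subseteq> H_space"
    and nonnull: "\<exists>f\<in>T. l2norm f \<noteq> 0"
    and tail: "\<And>f F. f \<in> T \<Longrightarrow> finite F \<Longrightarrow> (\<And>n. n \<in> F \<Longrightarrow> int N < \<bar>n\<bar>) \<Longrightarrow>
      (\<Sum>n\<in>F. (cmod (fourier f (\<omega> n)))\<^sup>2) \<le> \<epsilon> * sqn f"
  shows "Cconst \<omega> N T \<le> ereal (sqrt (B / (A - \<epsilon>)))"
proof -
  have AB: "0 < A" "A \<le> B"
    using frame by (auto simp: fourier_frame_def)
  let ?N = "{- int N..int N}"
  have lower: "A - \<epsilon> \<le> rayleigh \<omega> N f" if "f \<in> T" "l2norm f \<noteq> 0" for f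
  proof -
    let ?a = "\<lambda>n. (cmod (fourier f (\<omega> n)))\<^sup>2"
    have f: "f \<in> H_space" using that T by auto
    have pos: "0 < sqn f"
      using that sqn_nonneg[of f] by (auto simp: l2norm_eq_0_iff less_le)
    have sm: "?a summable_on UNIV" and low: "A * sqn f \<le> (\<Sum>\<^sub>\<infinity>n. ?a n)"
      using frame f by (auto simp: fourier_frame_def l2norm_power2)
    have sm_out: "?a summable_on (- ?N)"
      using sm by (rule summable_on_subset) simp
    have "(\<Sum>\<^sub>\<infinity>n. ?a n) = infsum ?a ?N + infsum ?a (- ?N)"
      using infsum_Un_disjoint[of ?a ?N "- ?N"] sm_out by simp
    also have "infsum ?a (- ?N) \<le> \<epsilon> * sqn f"
    proof (rule infsum_le_finite_sums[OF sm_out])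
      fix F :: "int set" assume F: "finite F" "F \<subseteq> - ?N"
      show "sum ?a F \<le> \<epsilon> * sqn f"
      proof (rule tail[OF that(1) F(1)])
        fix n assume "n \<in> F"
        then have "n \<notin> ?N" using F(2) by blast
        then show "int N < \<bar>n\<bar>" by simp linarith
      qed
    qed
    finally have "(A - \<epsilon>) * sqn f \<le> (\<Sum>n\<in>?N. ?a n)"
      using low by (simp add: left_diff_distrib)
    then show ?thesis
      using pos by (simp add: rayleigh_eq[OF f] le_divide_eq)
  qed
  have upper: "rayleigh \<omega> N f \<le> B" if "f \<in> H_space" "l2norm f \<noteq> 0" for f
  proof -
    have "0 < sqn f"
      using that sqn_nonneg[of f] by (auto simp: l2norm_eq_0_iff less_le)
    then show ?thesis
      using frame_bessel[OF frame that(1), of ?N] by (simp add: rayleigh_eq[OF that(1)] divide_le_eq)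
  qed
  have C1: "A - \<epsilon> \<le> C1 \<omega> N T"
    unfolding C1_def using nonnull lower by (intro cInf_greatest) auto
  have C2: "C2 \<omega> N \<le> B"
    unfolding C2_def using nonnull T upper by (intro cSup_least) auto
  have "C2 \<omega> N / C1 \<omega> N T \<le> B / C1 \<omega> N T"
    using C1 C2 \<open>\<epsilon> < A\<close> by (intro divide_right_mono) auto
  also have "\<dots> \<le> B / (A - \<epsilon>)"
    using C1 AB \<open>\<epsilon> < A\<close> by (intro divide_left_mono) auto
  finally show ?thesis
    using C1 \<open>\<epsilon> < A\<close> by (simp add: Cconst_def)
qed

section \<open>Linear operations on combinations of translates\<close>

lemma shift_combI:
  assumes "\<And>x. x \<notin> {0..1} \<Longrightarrow> f x = 0" "unit_comb \<phi> p R g" "\<And>x. x \<in> {0..1} \<Longrightarrow> f x = g x"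
  shows "shift_comb \<phi> p R f"
  using assms unfolding shift_comb_def unit_comb_def by simp

lemma unit_combI:
  "(\<And>x. x \<in> {0..1} \<Longrightarrow> f x = (\<Sum>n\<in>{- int p..2 ^ R + int p}. d n * \<phi> (2 ^ R * x - of_int n))) \<Longrightarrow>
    unit_comb \<phi> p R f"
  unfolding unit_comb_def by blast

lemma unit_comb_zero: "unit_comb \<phi> p R (\<lambda>x. 0)"
  by (rule unit_combI[where d = "\<lambda>_. 0"]) simp

lemma unit_comb_add:
  assumes "unit_comb \<phi> p R f" "unit_comb \<phi> p R g"
  shows "unit_comb \<phi> p R (\<lambda>x. f x + g x)"
proof -
  obtain d e where
    "\<And>x. x \<in> {0..1} \<Longrightarrow> f x = (\<Sum>n\<in>{- int p..2 ^ R + int p}. d n * \<phi> (2 ^ R * x - of_int n))"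
    "\<And>x. x \<in> {0..1} \<Longrightarrow> g x = (\<Sum>n\<in>{- int p..2 ^ R + int p}. e n * \<phi> (2 ^ R * x - of_int n))"
    using assms unfolding unit_comb_def by blast
  then show ?thesis
    by (intro unit_combI[where d = "\<lambda>n. d n + e n"]) (simp add: sum.distrib distrib_right)
qed

lemma unit_comb_cmult:
  assumes "unit_comb \<phi> p R f"
  shows "unit_comb \<phi> p R (\<lambda>x. c * f x)"
proof -
  obtain d where
    "\<And>x. x \<in> {0..1} \<Longrightarrow> f x = (\<Sum>n\<in>{- int p..2 ^ R + int p}. d n * \<phi> (2 ^ R * x - of_int n))"
    using assms unfolding unit_comb_def by blast
  then show ?thesis
    by (intro unit_combI[where d = "\<lambda>n. c * d n"]) (simp add: sum_distrib_left mult.assoc)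
qed

lemma unit_comb_sum:
  "(\<And>i. i \<in> I \<Longrightarrow> unit_comb \<phi> p R (f i)) \<Longrightarrow> unit_comb \<phi> p R (\<lambda>x. \<Sum>i\<in>I. f i x)"
  by (induction I rule: infinite_finite_induct) (auto intro: unit_comb_add unit_comb_zero)

section \<open>The reconstruction spaces\<close>

text \<open>The translates over one residue class modulo P: P = 2^R describes periodization, P = 2
  2^R folding, and P = 0 a single translate.\<close>

definition coset_sum :: "(real \<Rightarrow> complex) \<Rightarrow> int \<Rightarrow> int \<Rightarrow> real \<Rightarrow> complex" where
  "coset_sum \<phi> P r y = (\<Sum>\<^sub>\<infinity>n\<in>{n::int. P dvd n - r}. \<phi> (y - of_int n))"

lemma coset_sum_eq_sum:
  assumes "finite S" "\<And>n. n \<notin> S \<Longrightarrow> \<phi> (y - of_int n) = 0"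
  shows "coset_sum \<phi> P r y = (\<Sum>n\<in>S. if P dvd n - r then \<phi> (y - of_int n) else 0)"
proof -
  have "coset_sum \<phi> P r y = (\<Sum>\<^sub>\<infinity>n\<in>S. if P dvd n - r then \<phi> (y - of_int n) else 0)"
    unfolding coset_sum_def by (rule infsum_cong_neutral) (use assms(2) in auto)
  then show ?thesis using assms(1) by simp
qed

lemma coset_sum_cong: "P dvd r - s \<Longrightarrow> coset_sum \<phi> P r y = coset_sum \<phi> P s y"
proof -
  assume "P dvd r - s"
  then have "P dvd n - r \<longleftrightarrow> P dvd n - s" for n
    using dvd_add_right_iff[of P "r - s" "n - r"] by simp
  then show ?thesis by (simp add: coset_sum_def)
qed

lemma infsum_coset_plus:
  assumes "P \<noteq> 0"
  shows "(\<Sum>\<^sub>\<infinity>l. \<phi> (y - of_int (r + P * l))) = coset_sum \<phi> P r y"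
proof -
  have "{n. P dvd n - r} = range (\<lambda>l. r + P * l)"
  proof safe
    fix n assume "P dvd n - r"
    then obtain l where "n - r = P * l" by (elim dvdE)
    then show "n \<in> range (\<lambda>l. r + P * l)" by (intro image_eqI[of _ _ l]) auto
  qed simp
  moreover have "inj (\<lambda>l. r + P * l)"
    using assms by (auto simp: inj_on_def)
  ultimately show ?thesis
    unfolding coset_sum_def by (simp add: infsum_reindex o_def)
qed

lemma infsum_coset_minus:
  assumes "P \<noteq> 0"
  shows "(\<Sum>\<^sub>\<infinity>l. \<phi> (y - of_int (r - P * l))) = coset_sum \<phi> P r y"
  using infsum_coset_plus[of "- P" \<phi> y r] assms by (simp add: coset_sum_def)

text \<open>The classes of 0, ..., P - 1 partition the integers, so adding them up restores the sum
  over all translates.\<close>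

lemma sum_coset_sum:
  assumes "finite S" "\<And>n. n \<notin> S \<Longrightarrow> \<phi> (y - of_int n) = 0" "0 < P"
  shows "(\<Sum>k<P. coset_sum \<phi> (int P) (int k) y) = (\<Sum>n\<in>S. \<phi> (y - of_int n))"
proof -
  have "(\<Sum>k<P. coset_sum \<phi> (int P) (int k) y) =
      (\<Sum>n\<in>S. \<Sum>k<P. if int P dvd n - int k then \<phi> (y - of_int n) else 0)"
  proof -
    have "coset_sum \<phi> (int P) (int k) y = (\<Sum>n\<in>S. if int P dvd n - int k then \<phi> (y - of_int n) else 0)" for k
      by (rule coset_sum_eq_sum) (use assms in auto)
    then show ?thesis by (simp only:) (rule sum.swap)
  qed
  also have "\<dots> = (\<Sum>n\<in>S. \<phi> (y - of_int n))"
  proof (rule sum.cong[OF refl])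
    fix n assume "n \<in> S"
    have "int P dvd n - int k \<longleftrightarrow> k = nat (n mod int P)" if "k < P" for k
    proof -
      have "int P dvd n - int k \<longleftrightarrow> n mod int P = int k"
        using that by (simp flip: mod_eq_dvd_iff)
      also have "\<dots> \<longleftrightarrow> k = nat (n mod int P)"
        using assms(3) by auto
      finally show ?thesis .
    qed
    then have "(\<Sum>k<P. if int P dvd n - int k then \<phi> (y - of_int n) else 0) =
        (\<Sum>k<P. if k = nat (n mod int P) then \<phi> (y - of_int n) else 0)"
      by (intro sum.cong) auto
    also have "\<dots> = \<phi> (y - of_int n)"
      using assms(3) by (simp add: nat_less_iff)
    finally show "(\<Sum>k<P. if int P dvd n - int k then \<phi> (y - of_int n) else 0) = \<phi> (y - of_int n)" .
  qed
  finally show ?thesis .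
qed

lemma phi_per_eq:
  "phi_per \<phi> R k x = of_real (2 powr (real R / 2)) * coset_sum \<phi> (2 ^ R) k (2 ^ R * x)"
proof -
  have "phi_per \<phi> R k x =
      of_real (2 powr (real R / 2)) * (\<Sum>\<^sub>\<infinity>l. \<phi> (2 ^ R * x - of_int (k - 2 ^ R * l)))"
    unfolding phi_per_def phiRk_def infsum_cmult_right' by (simp add: algebra_simps)
  then show ?thesis
    using infsum_coset_minus[of "2 ^ R" \<phi> "2 ^ R * x" k] by simp
qed

text \<open>The symmetry of \<phi> turns each reflected term into an ordinary translate with index
  in the class of -k - s. Here s = 0 for symmetry about 0 and s = 1 for symmetry about 1/2.\<close>

lemma phi_fold_eq:
  assumes "\<And>z. \<phi> (of_int s - z) = \<phi> z"
  shows "phi_fold \<phi> R k x = of_real (2 powr (real R / 2)) *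
    (coset_sum \<phi> (2 * 2 ^ R) k (2 ^ R * x) + coset_sum \<phi> (2 * 2 ^ R) (- k - s) (2 ^ R * x))"
proof -
  have "(\<Sum>\<^sub>\<infinity>l. phiRk \<phi> R k (x - 2 * of_int l)) =
      of_real (2 powr (real R / 2)) * (\<Sum>\<^sub>\<infinity>l. \<phi> (2 ^ R * x - of_int (k + 2 * 2 ^ R * l)))"
    unfolding phiRk_def infsum_cmult_right' by (simp add: algebra_simps)
  moreover have "phiRk \<phi> R k (2 * of_int l - x) =
      of_real (2 powr (real R / 2)) * \<phi> (2 ^ R * x - of_int (- k - s + 2 * 2 ^ R * l))" for l
    using assms[of "2 ^ R * x - of_int (- k - s + 2 * 2 ^ R * l)"]
    by (simp add: phiRk_def algebra_simps)
  then have "(\<Sum>\<^sub>\<infinity>l. phiRk \<phi> R k (2 * of_int l - x)) =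
      of_real (2 powr (real R / 2)) * (\<Sum>\<^sub>\<infinity>l. \<phi> (2 ^ R * x - of_int (- k - s + 2 * 2 ^ R * l)))"
    by (simp only: infsum_cmult_right')
  ultimately show ?thesis
    unfolding phi_fold_def by (simp add: infsum_coset_plus[of "2 * 2 ^ R" \<phi> "2 ^ R * x" k, simplified]
      infsum_coset_plus[of "2 * 2 ^ R" \<phi> "2 ^ R * x" "- k - s", simplified] distrib_left)
qed

text \<open>Modulo 2M the reflection k to 2M - k fixes 0 and M, which would be counted twice; hence
  their weight 1/2.\<close>

lemma sum_reflect:
  fixes a :: "nat \<Rightarrow> complex"
  assumes "0 < M" "a (2 * M) = a 0"
  shows "(\<Sum>k\<in>{0..M}. (if k = 0 \<or> k = M then 1 / 2 else 1) * (a k + a (2 * M - k))) = (\<Sum>k<2 * M. a k)"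
proof -
  have eq: "{0..M} = insert 0 (insert M {1..<M})" "{..<2 * M} = insert 0 (insert M ({1..<M} \<union> {M<..<2 * M}))"
    using assms(1) by auto
  have "(\<Sum>k\<in>{M<..<2 * M}. a k) = (\<Sum>k\<in>{1..<M}. a (2 * M - k))"
    by (rule sum.reindex_bij_witness[of _ "\<lambda>k. 2 * M - k" "\<lambda>k. 2 * M - k"]) auto
  then have "(\<Sum>k<2 * M. a k) = a 0 + (a M + ((\<Sum>k\<in>{1..<M}. a k) + (\<Sum>k\<in>{1..<M}. a (2 * M - k))))"
    unfolding eq using assms(1) by (subst sum.insert; simp)+ (subst sum.union_disjoint; auto)
  moreover have "(\<Sum>k\<in>{1..<M}. (if k = 0 \<or> k = M then 1 / 2 else 1) * (a k + a (2 * M - k))) =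
      (\<Sum>k\<in>{1..<M}. a k + a (2 * M - k))"
    by (rule sum.cong) auto
  ultimately show ?thesis
    unfolding eq using assms by (simp add: sum.distrib mult_2[symmetric])
qed

text \<open>The reflection k to 2M - 1 - k has no fixed point, so no weights appear.\<close>

lemma sum_reflect':
  fixes a :: "nat \<Rightarrow> complex"
  shows "(\<Sum>k<M. a k + a (2 * M - 1 - k)) = (\<Sum>k<2 * M. a k)"
proof -
  have "(\<Sum>k<M. a (2 * M - 1 - k)) = (\<Sum>k\<in>{M..<2 * M}. a k)"
    by (rule sum.reindex_bij_witness[of _ "\<lambda>k. 2 * M - 1 - k" "\<lambda>k. 2 * M - 1 - k"]) auto
  moreover have "{..<2 * M} = {..<M} \<union> {M..<2 * M}" by auto
  moreover have "sum a ({..<M} \<union> {M..<2 * M}) = sum a {..<M} + sum a {M..<2 * M}"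
    by (rule sum.union_disjoint) auto
  ultimately show ?thesis by (simp add: sum.distrib)
qed

lemma scaling_functionE:
  assumes "scaling_function \<phi>"
  obtains V\<^sub>0 where "l2_subspace V\<^sub>0" "riesz_basis_translates \<phi> V\<^sub>0"
  using assms unfolding scaling_function_def is_MRA_def by blast

lemma scaling_function_L2:
  assumes "scaling_function \<phi>"
  shows "L2 \<phi>"
proof -
  obtain V\<^sub>0 where V: "l2_subspace V\<^sub>0" "riesz_basis_translates \<phi> V\<^sub>0"
    using assms by (rule scaling_functionE)
  then have "(\<lambda>x. \<phi> (x - of_int 0)) \<in> V\<^sub>0"
    unfolding riesz_basis_translates_def by blast
  then show ?thesis
    using V(1) by (simp add: l2_subspace_def)
qed

section \<open>The three spaces as combinations of translates\<close>

locale supported =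
  fixes \<phi> :: "real \<Rightarrow> complex" and p :: nat
  assumes supp: "\<forall>x. x \<notin> {- real p + 1..real p} \<longrightarrow> \<phi> x = 0"
begin

lemma zero_left: "y < 1 - real p \<Longrightarrow> \<phi> y = 0"
  using supp by auto

lemma zero_right: "real p < y \<Longrightarrow> \<phi> y = 0"
  using supp by auto

lemma shift_outside_window:
  assumes "x \<in> {0..1}" "n \<notin> {- int p..2 ^ R + int p}"
  shows "\<phi> (2 ^ R * x - of_int n) = 0"
proof (cases "n < - int p")
  case True
  then have "real_of_int n < - real p" by linarith
  moreover have "0 \<le> 2 ^ R * x" using assms by simp
  ultimately show ?thesis by (intro zero_right) linarith
next
  case False
  then have "2 ^ R + int p < n" using assms by auto
  then have "real_of_int (2 ^ R + int p) < of_int n" by (simp only: of_int_less_iff)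
  then have "2 ^ R + real p < of_int n" by simp
  moreover have "2 ^ R * x \<le> 2 ^ R" using assms by simp
  ultimately show ?thesis by (intro zero_left) linarith
qed

lemma unit_comb_coset_sum: "unit_comb \<phi> p R (\<lambda>x. coset_sum \<phi> P r (2 ^ R * x))"
  using shift_outside_window
  by (intro unit_combI[where d = "\<lambda>n. if P dvd n - r then 1 else 0"])
    (subst coset_sum_eq_sum[of "{- int p..2 ^ R + int p}"], auto intro: sum.cong)

text \<open>Divisibility by 0 means equality, so this is the coset sum with modulus 0. The index k
  may lie outside the window; the translate is then zero on [0,1].\<close>

lemma unit_comb_shift: "unit_comb \<phi> p R (\<lambda>x. \<phi> (2 ^ R * x - of_int k))"
proof -
  have "coset_sum \<phi> 0 k y = \<phi> (y - of_int k)" for y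
    by (simp add: coset_sum_def)
  then show ?thesis
    using unit_comb_coset_sum[of R 0 k] by simp
qed

lemma T_per_shift_comb: "f \<in> T_per \<phi> R \<Longrightarrow> shift_comb \<phi> p R f"
proof -
  assume "f \<in> T_per \<phi> R"
  then obtain c where f: "f = (\<lambda>x. (\<Sum>k<2 ^ R. c k * phi_per \<phi> R (int k) x) * indicator {0..1} x)"
    by (auto simp: T_per_def)
  have "unit_comb \<phi> p R (\<lambda>x. \<Sum>k<2 ^ R. c k * phi_per \<phi> R (int k) x)"
    unfolding phi_per_eq by (intro unit_comb_sum unit_comb_cmult unit_comb_coset_sum)
  then show ?thesis by (rule shift_combI[rotated]) (auto simp: f)
qed

lemma T_fold_shift_comb:
  assumes "f \<in> T_fold \<phi> \<iota> R" "fold_iota \<phi> \<iota>"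
  shows "shift_comb \<phi> p R f"
proof -
  obtain c where f: "f = (\<lambda>x. (\<Sum>k\<in>{0..2 ^ R - \<iota>}. c k * phi_fold \<phi> R (int k) x) * indicator {0..1} x)"
    using assms(1) by (auto simp: T_fold_def)
  obtain s where s: "\<And>z. \<phi> (of_int s - z) = \<phi> z"
  proof -
    consider "\<forall>x. \<phi> (- x) = \<phi> x" | "\<forall>x. \<phi> (1 - x) = \<phi> x"
      using assms(2) by (auto simp: fold_iota_def)
    then show ?thesis
      by cases (auto intro: that[of 0] that[of 1])
  qed
  have "unit_comb \<phi> p R (\<lambda>x. \<Sum>k\<in>{0..2 ^ R - \<iota>}. c k * phi_fold \<phi> R (int k) x)"
    unfolding phi_fold_eq[of \<phi> s, OF s]
    by (intro unit_comb_sum unit_comb_cmult unit_comb_add unit_comb_coset_sum)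
  then show ?thesis by (rule shift_combI[rotated]) (auto simp: f)
qed

text \<open>In the scaled variable the left edge functions reach at most to 2p - 1 and the right
  ones at least to 1 - 2p from their edge. So 2p \<le> 2^R keeps each from passing the opposite end
  of [0,1].\<close>

lemma T_bdry_shift_comb:
  assumes "f \<in> T_bdry \<phi> p R" "2 * p \<le> 2 ^ R"
  shows "shift_comb \<phi> p R f"
proof -
  let ?\<kappa> = "complex_of_real (2 powr (real R / 2))"
  obtain a b c where f: "f = (\<lambda>x. (\<Sum>m<p. a m * ?\<kappa> * L_edge \<phi> p m (2 ^ R * x)
      + b m * ?\<kappa> * R_edge \<phi> p m (2 ^ R * (x - 1))) + (\<Sum>k\<in>{p..<2 ^ R - p}. c k * phiRk \<phi> R (int k) x))"
    using assms(1) unfolding T_bdry_def by blast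
  have pR: "2 * real p \<le> 2 ^ R"
    using of_nat_mono[OF assms(2), where 'a = real] by simp
  have R1: "1 \<le> (2::real) ^ R" by simp
  show ?thesis
  proof (rule shift_combI)
    fix x :: real assume x: "x \<notin> {0..1}"
    have L: "L_edge \<phi> p m (2 ^ R * x) = 0" for m
    proof (cases "x < 0")
      case False
      then have "2 ^ R < 2 ^ R * x" using x by simp
      have "\<phi> (2 ^ R * x - of_int n) = 0" if "n \<in> {- int p + 1..int p - 1}" for n
      proof (rule zero_right)
        have "real_of_int n \<le> real p" using that by simp
        with \<open>2 ^ R < 2 ^ R * x\<close> pR show "real p < 2 ^ R * x - of_int n" by linarith
      qed
      then show ?thesis by (simp add: L_edge_def)
    next
      case True
      then have "2 ^ R * x < 0" by (simp add: mult_less_0_iff)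
      then show ?thesis by (simp add: L_edge_def)
    qed
    have R: "R_edge \<phi> p m (2 ^ R * (x - 1)) = 0" for m
    proof (cases "x < 0")
      case True
      then have "2 ^ R * x < 0" by (simp add: mult_less_0_iff)
      have "\<phi> (2 ^ R * (x - 1) - of_int n) = 0" if "n \<in> {- int p..int p - 1}" for n
      proof (rule zero_left)
        have "- real p \<le> real_of_int n" using that by simp
        with \<open>2 ^ R * x < 0\<close> pR show "2 ^ R * (x - 1) - of_int n < 1 - real p"
          unfolding right_diff_distrib by linarith
      qed
      then show ?thesis by (simp add: R_edge_def)
    next
      case False
      then have "0 < 2 ^ R * (x - 1)" using x by simp
      then show ?thesis by (simp add: R_edge_def)
    qed
    have C: "phiRk \<phi> R (int k) x = 0" if k: "k \<in> {p..<2 ^ R - p}" for k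
    proof (cases "x < 0")
      case True
      then have "2 ^ R * x < 0" by (simp add: mult_less_0_iff)
      then show ?thesis using k by (simp add: phiRk_def zero_left)
    next
      case False
      then have "2 ^ R < 2 ^ R * x" using x by simp
      moreover have "k + p \<le> 2 ^ R"
        using k by (simp add: less_diff_conv)
      then have "real k + real p \<le> 2 ^ R"
        using of_nat_mono[of "k + p" "2 ^ R", where 'a = real] by simp
      ultimately have "real p < 2 ^ R * x - of_int (int k)" unfolding of_int_of_nat_eq by linarith
      then show ?thesis unfolding phiRk_def by (simp only: zero_right mult_zero_right)
    qed
    show "f x = 0"
      unfolding f by (simp add: L R C)
  next
    \<comment> \<open>On [0,1] both closed half-line cut-offs equal 1, and the right edge index n,
      counted from the point 1, becomes 2^R + n.\<close>
    let ?g = "\<lambda>x. (\<Sum>m<p. a m * ?\<kappa> * (\<Sum>n\<in>{- int p + 1..int p - 1}. of_int n ^ m * \<phi> (2 ^ R * x - of_int n))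
        + b m * ?\<kappa> * (\<Sum>n\<in>{- int p..int p - 1}. of_int n ^ m * \<phi> (2 ^ R * x - of_int (2 ^ R + n))))
      + (\<Sum>k\<in>{p..<2 ^ R - p}. c k * (?\<kappa> * \<phi> (2 ^ R * x - of_int (int k))))"
    show "unit_comb \<phi> p R ?g"
      by (intro unit_comb_add unit_comb_sum unit_comb_cmult unit_comb_shift)
    show "f x = ?g x" if "x \<in> {0..1}" for x
      using that by (simp add: f L_edge_def R_edge_def phiRk_def mult_le_0_iff algebra_simps)
  qed
qed

section \<open>Functions of nonzero norm in the three spaces\<close>

lemma shift_outside_unit:
  assumes "y \<in> {0<..<1}" "n \<notin> {- int p..int p}"
  shows "\<phi> (y - of_int n) = 0"
proof (cases "n < - int p")
  case True
  then have "real_of_int n \<le> - real p - 1" by linarith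
  with assms show ?thesis by (intro zero_right) auto
next
  case False
  then have "int p < n" using assms by auto
  then have "real p + 1 \<le> real_of_int n" by linarith
  with assms show ?thesis by (intro zero_left) auto
qed

text \<open>Away from both ends every translate that reaches x is among the L chosen ones, so the
  finite sum is the full one and depends only on the fractional part of x.\<close>

lemma sum_shifts_interior:
  assumes "x \<notin> \<int>" "real p < x" "x < real L - real p"
  shows "(\<Sum>k\<in>{0..<int L}. \<phi> (x - of_int k)) = (\<Sum>n\<in>{- int p..int p}. \<phi> (frac x - of_int n))"
proof -
  let ?T = "{\<lfloor>x\<rfloor> - int p + 1..\<lfloor>x\<rfloor> + int p - 1}"
  have fl: "of_int \<lfloor>x\<rfloor> < x" "x < of_int \<lfloor>x\<rfloor> + 1"
  proof -
    show "of_int \<lfloor>x\<rfloor> < x"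
      using assms(1) by (metis Ints_of_int of_int_floor_le less_eq_real_def)
  qed linarith
  have zero: "\<phi> (x - of_int k) = 0" if "k \<notin> ?T" for k
  proof (cases "k < \<lfloor>x\<rfloor> - int p + 1")
    case True
    then have "of_int k \<le> of_int \<lfloor>x\<rfloor> - real p" by linarith
    with fl show ?thesis by (intro zero_right) linarith
  next
    case False
    then have "\<lfloor>x\<rfloor> + int p \<le> k" using that by auto
    then have "of_int \<lfloor>x\<rfloor> + real p \<le> of_int k" by linarith
    with fl show ?thesis by (intro zero_left) linarith
  qed
  have "int p \<le> \<lfloor>x\<rfloor>" "\<lfloor>x\<rfloor> + int p \<le> int L"
    using assms(2,3) by linarith+
  then have "(\<Sum>k\<in>{0..<int L}. \<phi> (x - of_int k)) = (\<Sum>k\<in>?T. \<phi> (x - of_int k))"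
    using zero by (intro sum.mono_neutral_right) auto
  also have "\<dots> = (\<Sum>k\<in>(\<lambda>n. \<lfloor>x\<rfloor> + n) ` {- int p..int p}. \<phi> (x - of_int k))"
  proof (rule sum.mono_neutral_left)
    show "?T \<subseteq> (\<lambda>n. \<lfloor>x\<rfloor> + n) ` {- int p..int p}"
    proof
      fix k assume "k \<in> ?T"
      then show "k \<in> (\<lambda>n. \<lfloor>x\<rfloor> + n) ` {- int p..int p}"
        by (intro image_eqI[of _ _ "k - \<lfloor>x\<rfloor>"]) auto
    qed
  qed (use zero in auto)
  also have "\<dots> = (\<Sum>n\<in>{- int p..int p}. \<phi> (frac x - of_int n))"
    by (subst sum.reindex) (auto simp: inj_on_def frac_def algebra_simps)
  finally show ?thesis .
qed

text \<open>If \<open>\<Sum>\<^sub>n \<phi>(\<sqdot> - n)\<close> vanished almost everywhere, the sum of \<open>L\<close> consecutive translates would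
  live near the two ends of its support, with a norm independent of \<open>L\<close>, against the lower Riesz bound.\<close>
lemma partition_sum_nonnull:
  assumes "scaling_function \<phi>"
  shows "\<not> (AE y in lborel. y \<in> {0<..<1} \<longrightarrow> (\<Sum>n\<in>{- int p..int p}. \<phi> (y - of_int n)) = 0)"
proof
  assume null: "AE y in lborel. y \<in> {0<..<1} \<longrightarrow> (\<Sum>n\<in>{- int p..int p}. \<phi> (y - of_int n)) = 0"
  have L2: "L2 \<phi>"
    using assms by (rule scaling_function_L2)
  then have [measurable]: "\<phi> \<in> borel_measurable borel"
    by (rule L2_borel_measurable)
  from assms obtain V\<^sub>0 where "riesz_basis_translates \<phi> V\<^sub>0"
    by (rule scaling_functionE)
  then obtain a where a: "a > 0"
    "\<And>(c :: int \<Rightarrow> complex) K. finite K \<Longrightarrow>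
      a * (\<Sum>k\<in>K. (cmod (c k))\<^sup>2) \<le> sqn (\<lambda>x. \<Sum>k\<in>K. c k * \<phi> (x - of_int k))"
    unfolding riesz_basis_translates_def l2norm_power2 by blast
  \<comment> \<open>The surviving left end, and below it the right end moved back by L to the
    origin. Neither depends on L.\<close>
  define h1 where "h1 x = (\<Sum>k\<in>{0..2 * int p}. \<phi> (x - of_int k)) * indicator {- real p..real p} x" for x
  define h2 where "h2 x = (\<Sum>k\<in>{- 2 * int p - 1..- 1}. \<phi> (x - of_int k)) * indicator {- real p..real p} x" for x
  have h_L2: "L2 h1" "L2 h2"
    unfolding h1_def h2_def using L2 by (intro L2_indicator_mult L2_sum L2_shift; simp)+
  have bound: "a * real L \<le> 2 * sqn h1 + 2 * sqn h2" if L: "2 * p < L" for L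
  proof -
    let ?F = "\<lambda>x. \<Sum>k\<in>{0..<int L}. \<phi> (x - of_int k)"
    \<comment> \<open>The null set of the assumption is carried to every unit cell; countably many
      translates still form a null set.\<close>
    have "AE x in lborel. \<forall>j::int. x + of_int j \<in> {0<..<1} \<longrightarrow>
        (\<Sum>n\<in>{- int p..int p}. \<phi> (x + of_int j - of_int n)) = 0"
    proof (subst AE_all_countable, rule allI)
      fix j :: int
      have "Measurable.pred borel (\<lambda>y. y \<in> {0<..<1} \<longrightarrow> (\<Sum>n\<in>{- int p..int p}. \<phi> (y - of_int n)) = 0)"
        by measurable
      from AE_borel_affine[OF _ this null, of 1 "of_int j"]
      show "AE x in lborel. x + of_int j \<in> {0<..<1} \<longrightarrow>
          (\<Sum>n\<in>{- int p..int p}. \<phi> (x + of_int j - of_int n)) = 0"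
        by (simp add: add.commute)
    qed
    moreover have "AE x in lborel. x \<notin> (\<int> :: real set)"
      by (rule AE_not_in) (auto intro!: countable_imp_null_set_lborel simp: Ints_def)
    ultimately have "AE x in lborel. ?F x = h1 x + h2 (x - real L)"
    proof eventually_elim
      case (elim x)
      have L': "2 * real p + 1 \<le> real L" using L by linarith
      \<comment> \<open>Outside the support, left end, interior, right end, outside again. The two
        ends are disjoint since 2p < L.\<close>
      consider "x < - real p" | "- real p \<le> x" "x \<le> real p" | "real p < x" "x < real L - real p"
        | "real L - real p \<le> x" "x \<le> real L + real p" | "real L + real p < x"
        by linarith
      then show ?case
      proof cases
        case 1
        then have "\<phi> (x - of_int k) = 0" if "k \<in> {0..<int L}" for k
          using that by (intro zero_left) auto
        with 1 L' show ?thesis by (simp add: h1_def h2_def)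
      next
        case 2
        have "?F x = (\<Sum>k\<in>{0..2 * int p}. \<phi> (x - of_int k))"
        proof (rule sum.mono_neutral_right)
          show "\<forall>k\<in>{0..<int L} - {0..2 * int p}. \<phi> (x - of_int k) = 0"
          proof
            fix k assume "k \<in> {0..<int L} - {0..2 * int p}"
            then have "2 * int p < k" by auto
            then have "2 * real p + 1 \<le> of_int k" by linarith
            with 2 show "\<phi> (x - of_int k) = 0" by (intro zero_left) linarith
          qed
        qed (use L in auto)
        with 2 L' show ?thesis by (simp add: h1_def h2_def)
      next
        case 3
        have "frac x \<in> {0<..<1}"
          using elim(2) frac_lt_1[of x] frac_gt_0_iff[of x] by auto
        then have "x + of_int (- \<lfloor>x\<rfloor>) \<in> {0<..<1}"
          by (simp add: frac_def)
        then have "(\<Sum>n\<in>{- int p..int p}. \<phi> (frac x - of_int n)) = 0"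
          using elim(1)[rule_format, of "- \<lfloor>x\<rfloor>"] by (simp add: frac_def)
        then have "?F x = 0"
          using sum_shifts_interior[OF elim(2) 3] by simp
        with 3 show ?thesis by (simp add: h1_def h2_def)
      next
        case 4
        have "?F x = (\<Sum>k\<in>{int L - 2 * int p - 1..<int L}. \<phi> (x - of_int k))"
        proof (rule sum.mono_neutral_right)
          show "\<forall>k\<in>{0..<int L} - {int L - 2 * int p - 1..<int L}. \<phi> (x - of_int k) = 0"
          proof
            fix k assume "k \<in> {0..<int L} - {int L - 2 * int p - 1..<int L}"
            then have "k + 2 \<le> int L - 2 * int p" by auto
            then have "of_int k + 2 \<le> real L - 2 * real p" by linarith
            with 4 show "\<phi> (x - of_int k) = 0" by (intro zero_right) linarith
          qed
        qed (use L in auto)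
        also have "\<dots> = (\<Sum>k\<in>{- 2 * int p - 1..- 1}. \<phi> (x - real L - of_int k))"
          by (rule sum.reindex_bij_witness[of _ "\<lambda>k. k + int L" "\<lambda>k. k - int L"]) auto
        finally show ?thesis using 4 L' by (simp add: h1_def h2_def)
      next
        case 5
        have "\<phi> (x - of_int k) = 0" if "k \<in> {0..<int L}" for k
        proof -
          have "of_int k \<le> real L" using that by (simp add: of_int_le_iff[of k "int L", symmetric])
          with 5 show ?thesis by (intro zero_right) linarith
        qed
        with 5 L' show ?thesis by (simp add: h1_def h2_def)
      qed
    qed
    then have "sqn ?F = sqn (\<lambda>x. h1 x + h2 (x - real L))"
      using L2 h_L2 by (intro sqn_cong_AE L2_sum L2_add L2_shift)
    also have "\<dots> \<le> 2 * sqn h1 + 2 * sqn h2"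
      using sqn_add_le[OF h_L2(1) L2_shift[OF h_L2(2)], of "real L"] by (simp add: sqn_shift)
    finally show ?thesis
      using a(2)[of "{0..<int L}" "\<lambda>_. 1"] by simp
  qed
  \<comment> \<open>With all coefficients 1 the lower Riesz bound grows like a L, so any L beyond
    this quotient gives the contradiction.\<close>
  obtain m :: nat where m: "(2 * sqn h1 + 2 * sqn h2) / a < real m"
    using reals_Archimedean2 by blast
  define L where "L = m + 2 * p + 1"
  have "a * real L \<le> 2 * sqn h1 + 2 * sqn h2"
    by (rule bound) (simp add: L_def)
  moreover have "2 * sqn h1 + 2 * sqn h2 < a * real m"
    using m a(1) by (simp add: divide_less_eq mult.commute)
  moreover have "a * real m \<le> a * real L"
    using a(1) by (intro mult_left_mono) (auto simp: L_def)
  ultimately show False by linarith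
qed

text \<open>If f were null, its rescaled restriction to the first cell would be null too, against
  \<open>partition_sum_nonnull\<close>.\<close>

lemma l2norm_nonzero:
  assumes "scaling_function \<phi>" "L2 f" "\<kappa> \<noteq> 0"
    and f: "\<And>y. y \<in> {0<..<1} \<Longrightarrow> f (y / 2 ^ R) = \<kappa> * (\<Sum>n\<in>{- int p..int p}. \<phi> (y - of_int n))"
  shows "l2norm f \<noteq> 0"
proof
  assume "l2norm f = 0"
  then have "AE x in lborel. f x = 0"
    using assms(2) by (simp add: l2norm_eq_0_iff sqn_eq_0_iff)
  moreover have "Measurable.pred borel (\<lambda>x. f x = 0)"
    using L2_borel_measurable[OF assms(2)] by measurable
  ultimately have "AE y in lborel. f (0 + 1 / 2 ^ R * y) = 0"
    by (intro AE_borel_affine) auto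
  then have "AE y in lborel. y \<in> {0<..<1} \<longrightarrow> (\<Sum>n\<in>{- int p..int p}. \<phi> (y - of_int n)) = 0"
    by eventually_elim (use f assms(3) in auto)
  then show False
    using partition_sum_nonnull[OF assms(1)] by blast
qed

lemma sum_coset_sum_unit:
  assumes "y \<in> {0<..<1}" "0 < P"
  shows "(\<Sum>k<P. coset_sum \<phi> (int P) (int k) y) = (\<Sum>n\<in>{- int p..int p}. \<phi> (y - of_int n))"
  by (rule sum_coset_sum) (use assms shift_outside_unit in auto)

lemma unit_scaled:
  fixes y :: real
  assumes "y \<in> {0<..<1}"
  shows "y / 2 ^ R \<in> {0..1}" "y / 2 ^ R \<in> {0<..<1}"
proof -
  have "y < 2 ^ R"
    using assms order_less_le_trans[of y 1 "2 ^ R"] by simp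
  then show "y / 2 ^ R \<in> {0<..<1}" using assms by simp
  then show "y / 2 ^ R \<in> {0..1}" by simp
qed

lemma T_per_unit:
  obtains f \<kappa> where "f \<in> T_per \<phi> R" "\<kappa> \<noteq> 0"
    "\<And>y. y \<in> {0<..<1} \<Longrightarrow> f (y / 2 ^ R) = \<kappa> * (\<Sum>n\<in>{- int p..int p}. \<phi> (y - of_int n))"
proof
  let ?f = "\<lambda>x. (\<Sum>k<2 ^ R. 1 * phi_per \<phi> R (int k) x) * indicator {0..1} x"
  show "?f \<in> T_per \<phi> R"
    unfolding T_per_def by (rule CollectI, rule exI[of _ "\<lambda>_. 1"]) simp
  fix y :: real assume y: "y \<in> {0<..<1}"
  show "?f (y / 2 ^ R) = of_real (2 powr (real R / 2)) * (\<Sum>n\<in>{- int p..int p}. \<phi> (y - of_int n))"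
    using sum_coset_sum_unit[OF y, of "2 ^ R"] unit_scaled[OF y, of R]
    by (simp add: phi_per_eq flip: sum_distrib_left)
qed simp

lemma T_fold_unit:
  assumes "fold_iota \<phi> \<iota>"
  obtains f \<kappa> where "f \<in> T_fold \<phi> \<iota> R" "\<kappa> \<noteq> 0"
    "\<And>y. y \<in> {0<..<1} \<Longrightarrow> f (y / 2 ^ R) = \<kappa> * (\<Sum>n\<in>{- int p..int p}. \<phi> (y - of_int n))"
proof -
  let ?\<kappa> = "complex_of_real (2 powr (real R / 2))"
  let ?M = "2 ^ R :: nat"
  let ?a = "\<lambda>y k. coset_sum \<phi> (int (2 * ?M)) (int k) y"
  have total: "(\<Sum>k<2 * ?M. ?a y k) = (\<Sum>n\<in>{- int p..int p}. \<phi> (y - of_int n))" if "y \<in> {0<..<1}" for y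
    by (rule sum_coset_sum_unit[OF that]) simp
  consider (sym) "\<iota> = 0" "\<And>x. \<phi> (- x) = \<phi> x" | (antisym) "\<iota> = 1" "\<And>x. \<phi> (1 - x) = \<phi> x"
    using assms by (auto simp: fold_iota_def)
  then show thesis
  proof cases
    case sym
    \<comment> \<open>The generators k = 0 and k = 2^R coincide with their mirror images, hence the
      weights of \<open>sum_reflect\<close>.\<close>
    let ?c = "\<lambda>k. if k = 0 \<or> k = ?M then 1 / 2 else 1 :: complex"
    let ?f = "\<lambda>x. (\<Sum>k\<in>{0..?M - \<iota>}. ?c k * phi_fold \<phi> R (int k) x) * indicator {0..1} x"
    have fold: "phi_fold \<phi> R (int k) x = ?\<kappa> * (?a (2 ^ R * x) k + ?a (2 ^ R * x) (2 * ?M - k))"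
      if "k \<in> {0..?M}" for k x
    proof -
      have "coset_sum \<phi> (2 * 2 ^ R) (- int k - 0) (2 ^ R * x) = coset_sum \<phi> (2 * 2 ^ R) (int (2 * ?M - k)) (2 ^ R * x)"
        by (rule coset_sum_cong) (use that in \<open>auto simp: of_nat_diff\<close>)
      then show ?thesis
        using phi_fold_eq[of \<phi> 0 R "int k" x] sym(2) by simp
    qed
    show thesis
    proof (rule that)
      show "?f \<in> T_fold \<phi> \<iota> R"
        unfolding T_fold_def by (rule CollectI, rule exI[of _ ?c]) simp
      show "?\<kappa> \<noteq> 0" by simp
      fix y :: real assume y: "y \<in> {0<..<1}"
      have "(\<Sum>k\<in>{0..?M}. ?c k * phi_fold \<phi> R (int k) (y / 2 ^ R)) =
          ?\<kappa> * (\<Sum>k\<in>{0..?M}. ?c k * (?a y k + ?a y (2 * ?M - k)))"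
        unfolding sum_distrib_left by (rule sum.cong[OF refl]) (simp only: fold, simp)
      also have "(\<Sum>k\<in>{0..?M}. ?c k * (?a y k + ?a y (2 * ?M - k))) = (\<Sum>k<2 * ?M. ?a y k)"
        by (rule sum_reflect) (auto intro!: coset_sum_cong)
      finally show "?f (y / 2 ^ R) = ?\<kappa> * (\<Sum>n\<in>{- int p..int p}. \<phi> (y - of_int n))"
        using unit_scaled[OF y, of R] total[OF y] sym(1) by simp
    qed
  next
    case antisym
    let ?f = "\<lambda>x. (\<Sum>k\<in>{0..?M - \<iota>}. 1 * phi_fold \<phi> R (int k) x) * indicator {0..1} x"
    have fold: "phi_fold \<phi> R (int k) x = ?\<kappa> * (?a (2 ^ R * x) k + ?a (2 ^ R * x) (2 * ?M - 1 - k))"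
      if "k < ?M" for k x
    proof -
      have "coset_sum \<phi> (2 * 2 ^ R) (- int k - 1) (2 ^ R * x) = coset_sum \<phi> (2 * 2 ^ R) (int (2 * ?M - 1 - k)) (2 ^ R * x)"
        by (rule coset_sum_cong) (use that in \<open>auto simp: of_nat_diff\<close>)
      then show ?thesis
        using phi_fold_eq[of \<phi> 1 R "int k" x] antisym(2) by simp
    qed
    show thesis
    proof (rule that)
      show "?f \<in> T_fold \<phi> \<iota> R"
        unfolding T_fold_def by (rule CollectI, rule exI[of _ "\<lambda>_. 1"]) simp
      show "?\<kappa> \<noteq> 0" by simp
      fix y :: real assume y: "y \<in> {0<..<1}"
      have set: "{0..?M - 1} = {..<?M}"
        by (simp add: atLeast0AtMost flip: lessThan_Suc_atMost)
      have "(\<Sum>k<?M. phi_fold \<phi> R (int k) (y / 2 ^ R)) =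
          ?\<kappa> * (\<Sum>k<?M. ?a y k + ?a y (2 * ?M - 1 - k))"
        unfolding sum_distrib_left by (rule sum.cong[OF refl]) (simp add: fold)
      also have "(\<Sum>k<?M. ?a y k + ?a y (2 * ?M - 1 - k)) = (\<Sum>k<2 * ?M. ?a y k)"
        by (rule sum_reflect')
      finally show "?f (y / 2 ^ R) = ?\<kappa> * (\<Sum>n\<in>{- int p..int p}. \<phi> (y - of_int n))"
        using unit_scaled[OF y, of R] total[OF y] antisym(1) set by simp
    qed
  qed
qed

lemma T_bdry_unit:
  assumes "1 \<le> p"
  obtains f \<kappa> where "f \<in> T_bdry \<phi> p R" "\<kappa> \<noteq> 0"
    "\<And>y. y \<in> {0<..<1} \<Longrightarrow> f (y / 2 ^ R) = \<kappa> * (\<Sum>n\<in>{- int p..int p}. \<phi> (y - of_int n))"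
proof
  let ?\<kappa> = "complex_of_real (2 powr (real R / 2))"
  \<comment> \<open>For m = 0 the weights n^m are all 1 (including 0^0), so this left edge function
    alone is the partition sum on the first cell.\<close>
  let ?e = "\<lambda>m. if m = 0 then 1 else 0 :: complex"
  let ?f = "\<lambda>x. (\<Sum>m<p. ?e m * ?\<kappa> * L_edge \<phi> p m (2 ^ R * x)
      + 0 * ?\<kappa> * R_edge \<phi> p m (2 ^ R * (x - 1))) + (\<Sum>k\<in>{p..<2 ^ R - p}. 0 * phiRk \<phi> R (int k) x)"
  show "?f \<in> T_bdry \<phi> p R"
    unfolding T_bdry_def
    by (rule CollectI, rule exI[of _ ?e], rule exI[of _ "\<lambda>_. 0"], rule exI[of _ "\<lambda>_. 0"]) simp
  fix y :: real assume y: "y \<in> {0<..<1}"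
  have "?f (y / 2 ^ R) = (\<Sum>m<p. ?e m * ?\<kappa> * L_edge \<phi> p m y)"
    by simp
  also have "\<dots> = ?\<kappa> * L_edge \<phi> p 0 y"
    using assms by (subst sum.remove[of _ 0]) auto
  also have "L_edge \<phi> p 0 y = (\<Sum>n\<in>{- int p + 1..int p - 1}. \<phi> (y - of_int n))"
    using y by (simp add: L_edge_def)
  also have "\<dots> = (\<Sum>n\<in>{- int p..int p}. \<phi> (y - of_int n))"
  proof (rule sum.mono_neutral_left)
    show "\<forall>n\<in>{- int p..int p} - {- int p + 1..int p - 1}. \<phi> (y - of_int n) = 0"
    proof
      fix n assume "n \<in> {- int p..int p} - {- int p + 1..int p - 1}"
      then have "n = - int p \<or> n = int p" by auto
      then show "\<phi> (y - of_int n) = 0"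
        using y by (auto intro: zero_left zero_right)
    qed
  qed auto
  finally show "?f (y / 2 ^ R) = ?\<kappa> * (\<Sum>n\<in>{- int p..int p}. \<phi> (y - of_int n))" .
qed simp

end

theorem theorem5p5:
  fixes \<omega> :: "int \<Rightarrow> real" and A B \<epsilon> :: real and \<phi> :: "real \<Rightarrow> complex"
    and p :: nat and kind :: wavelet_kind
  assumes "mono \<omega>"
    and "fourier_frame \<omega> A B"
    and "scaling_function \<phi>"
    and "p \<ge> 1"
    and "\<forall>x. x \<notin> {- real p + 1..real p} \<longrightarrow> \<phi> x = 0"
    and "\<exists>c \<alpha>. \<alpha> > 1/2 \<and> (\<forall>w. cmod (fourier \<phi> w) \<le> c * (1 + \<bar>w\<bar>) powr (- \<alpha>))"
    and "\<forall>\<iota>. kind = Folded \<iota> \<longrightarrow> fold_iota \<phi> \<iota>"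
    and "0 < \<epsilon>" and "\<epsilon> < A"
  shows "\<exists>c0. \<forall>N R. real N \<ge> c0 * 2 ^ R \<longrightarrow> (kind = Boundary \<longrightarrow> 2 ^ R \<ge> 2 * p) \<longrightarrow>
           Cconst \<omega> N (recon_space kind \<phi> p R) \<le> ereal (sqrt (B / (A - \<epsilon>)))"
proof -
  interpret supported \<phi> p
    by unfold_locales fact
  have L2: "L2 \<phi>"
    using assms(3) by (rule scaling_function_L2)
  obtain c0 where c0: "\<And>N R f F. c0 * 2 ^ R \<le> real N \<Longrightarrow> shift_comb \<phi> p R f \<Longrightarrow> finite F \<Longrightarrow>
      (\<And>n. n \<in> F \<Longrightarrow> int N < \<bar>n\<bar>) \<Longrightarrow> (\<Sum>n\<in>F. (cmod (fourier f (\<omega> n)))\<^sup>2) \<le> \<epsilon> * sqn f"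
    using shift_comb_tail[OF assms(2,1) L2 assms(5,8)] by blast
  show ?thesis
  proof (intro exI[of _ c0] allI impI)
    fix N R assume N: "c0 * 2 ^ R \<le> real N" and R: "kind = Boundary \<longrightarrow> 2 ^ R \<ge> 2 * p"
    let ?T = "recon_space kind \<phi> p R"
    have comb: "shift_comb \<phi> p R f" if "f \<in> ?T" for f
      using that R assms(7)
      by (cases kind) (auto intro: T_per_shift_comb T_fold_shift_comb T_bdry_shift_comb)
    then have H: "?T \<subseteq> H_space"
      using shift_comb_H_space[OF L2] by blast
    \<comment> \<open>A witness with nonzero norm for every R, without which the infimum in
      \<open>C1\<close> would range over an empty set.\<close>
    have "\<exists>f\<in>?T. \<exists>\<kappa>. \<kappa> \<noteq> 0 \<and>
        (\<forall>y\<in>{0<..<1}. f (y / 2 ^ R) = \<kappa> * (\<Sum>n\<in>{- int p..int p}. \<phi> (y - of_int n)))"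
    proof (cases kind)
      case Periodic
      obtain f \<kappa> where "f \<in> T_per \<phi> R" "\<kappa> \<noteq> 0"
        "\<And>y. y \<in> {0<..<1} \<Longrightarrow> f (y / 2 ^ R) = \<kappa> * (\<Sum>n\<in>{- int p..int p}. \<phi> (y - of_int n))"
        by (rule T_per_unit[of R]) blast
      with Periodic show ?thesis
        by (intro bexI[of _ f] exI[of _ \<kappa>]) simp_all
    next
      case (Folded \<iota>)
      with assms(7) have "fold_iota \<phi> \<iota>" by simp
      then obtain f \<kappa> where "f \<in> T_fold \<phi> \<iota> R" "\<kappa> \<noteq> 0"
        "\<And>y. y \<in> {0<..<1} \<Longrightarrow> f (y / 2 ^ R) = \<kappa> * (\<Sum>n\<in>{- int p..int p}. \<phi> (y - of_int n))"
        by (rule T_fold_unit[of \<iota> R]) blast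
      with Folded show ?thesis
        by (intro bexI[of _ f] exI[of _ \<kappa>]) simp_all
    next
      case Boundary
      obtain f \<kappa> where "f \<in> T_bdry \<phi> p R" "\<kappa> \<noteq> 0"
        "\<And>y. y \<in> {0<..<1} \<Longrightarrow> f (y / 2 ^ R) = \<kappa> * (\<Sum>n\<in>{- int p..int p}. \<phi> (y - of_int n))"
        using assms(4) by (rule T_bdry_unit[of R]) blast
      with Boundary show ?thesis
        by (intro bexI[of _ f] exI[of _ \<kappa>]) simp_all
    qed
    then obtain f \<kappa> where f: "f \<in> ?T" "\<kappa> \<noteq> 0"
      "\<And>y. y \<in> {0<..<1} \<Longrightarrow> f (y / 2 ^ R) = \<kappa> * (\<Sum>n\<in>{- int p..int p}. \<phi> (y - of_int n))"
      by blast
    then have "l2norm f \<noteq> 0"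
      using H by (intro l2norm_nonzero[OF assms(3) _ f(2,3)]) (auto simp: H_space_def)
    then have "\<exists>f\<in>?T. l2norm f \<noteq> 0" using f(1) by blast
    then show "Cconst \<omega> N ?T \<le> ereal (sqrt (B / (A - \<epsilon>)))"
      by (rule Cconst_le[OF assms(2,9) H]) (rule c0[OF N comb])
  qed
qed

end
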